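(* Let $k\ge 2$, let $A_{X_k}$ and $A_{T_k}$ be the adjacency operators of $X_k$ and $T_k$, where $V(X_k) \subset V_k$. (a) Every eigenfunction $F$ of $A_{T_k}$ with eigenvalue $\lambda \in [-3,3]$ gives rise to an eigenfunction $f$ of $A_{X_k}$ with eigenvalue $\mu = \lambda^2 - 3 \in [-3,6]$, given by $f(v) = F(v)$ for all $v \in V(X_k)$. (b) Every eigenfunction $f$ of $A_{X_k}$ with eigenvalue $\mu \in [-6,6]\setminus\{-3\}$ gives rise to two eigenfunctions $F_\pm$ of $A_{T_k}$ with eigenvalues $\pm\sqrt{\mu+3}$, given by $F_\pm(v) = f(v)$ for $v \in V(X_k)$ and $F_\pm(v) = \pm\frac{1}{\sqrt{\mu+3}}\sum_{w \sim v} f(w)$ for $v \in V_k \setminus V(X_k)$ (with $\sim$ adjacency in $T_k$). (c) Let $f$ be an eigenfunction of $A_{X_k}$ with eigenvalue $-3$, and define $F$ on $V_k$ by $F(v) = f(v)$ for $v \in V(X_k)$ and $F(v) = 0$ for $v \in V_k \setminus V(X_k)$. Then $F$ is an eigenfunction of $A_{T_k}$ with eigenvalue $0$ if and only if $\sum_{v \in \Delta} f(v) = 0$ for every triangle $\Delta \subset V(X_k)$ of $X_k$.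
   Context: Let $\widetilde G = \langle x_0,\dots,x_6 \mid x_i x_{i+1} x_{i+3}\ (i=0,\dots,6)\rangle$ (indices mod $7$), $G \le \widetilde G$ the index-two subgroup generated by $x_0,x_1$ (containing $x_3=x_1^{-1}x_0^{-1}$), $S=\{x_0^{\pm1},x_1^{\pm1},x_3^{\pm1}\}$. $G$ has a fixed faithful representation (Peyerimhoff–Vdovina, after Cartwright–Mantero–Steger–Zappa) by infinite upper triangular block Toeplitz matrices with identity $3\times 3$ diagonal blocks over $\mathbb F_2$ and $3$-periodic upper block diagonals with entries in $M(3,\mathbb F_2)$; $G^k$ is the normal subgroup of elements whose matrices have vanishing first $k$ upper block diagonals, $G_k=G/G^k$, images of $x_i$ keep their names. $X_k=\mathrm{Cay}(G_k,S)$ ($6$-regular). Its triangles are the sets $\{h,hx_0,hx_0x_1\}$ ($h\in G_k$; $hx_0x_1=hx_3^{-1}$). $T_k$, with vertex set $V_k$, is obtained from $X_k$ by the $(\Delta-Y)$-transformation: for every triangle one adds a new vertex adjacent to its three vertices and removes the three edges of the triangle; thus $V(X_k)=G_k\subset V_k$. The adjacency operator of a graph acts on functions on vertices by $Af(v)=\sum_{w\sim v} f(w)$. *)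

theory Defs
  imports
    "HOL-Analysis.Analysis"
    "HOL-Algebra.Elementary_Groups"
    "HOL-Library.Z2"
begin

section \<open>Groups given by generators and relators\<close>

text \<open>The letter \<open>(a, True)\<close> stands for the generator \<open>a\<close> and \<open>(a, False)\<close> for its inverse.\<close>

type_synonym 'a gword = "('a \<times> bool) list"

definition gwords :: "'a set \<Rightarrow> 'a gword set" where
  "gwords X = lists (X \<times> UNIV)"

definition word_step :: "'a set \<Rightarrow> 'a gword set \<Rightarrow> ('a gword \<times> 'a gword) set" where
  "word_step X R =
     {(u @ r @ v, u @ v) | u r v.
        u \<in> gwords X \<and> v \<in> gwords X \<and>
        r \<in> R \<union> {[(a, e), (a, \<not> e)] | a e. a \<in> X}}"

definition word_rel :: "'a set \<Rightarrow> 'a gword set \<Rightarrow> ('a gword \<times> 'a gword) set" where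
  "word_rel X R = (word_step X R \<union> (word_step X R)\<inverse>)\<^sup>*"

definition presented_group :: "'a set \<Rightarrow> 'a gword set \<Rightarrow> 'a gword set monoid" where
  "presented_group X R =
     \<lparr>carrier = gwords X // word_rel X R,
      mult = (\<lambda>A B. \<Union>a\<in>A. \<Union>b\<in>B. word_rel X R `` {a @ b}),
      one = word_rel X R `` {[]}\<rparr>"


section \<open>The group \<open>G\<close>\<close>

type_synonym elt = "nat gword set"

definition Gt_relators :: "nat gword set" where
  "Gt_relators =
     {[(i, True), ((i + 1) mod 7, True), ((i + 3) mod 7, True)] | i. i < 7}"

definition Gt :: "elt monoid" where
  "Gt = presented_group {0..<7} Gt_relators"

definition xgen :: "nat \<Rightarrow> elt" where
  "xgen i = word_rel {0..<7} Gt_relators `` {[(i, True)]}"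

definition GG :: "elt monoid" where
  "GG = subgroup_generated Gt {xgen 0, xgen 1}"


section \<open>The representation by infinite block matrices\<close>

text \<open>Infinite matrices with entries in the ring of \<open>3 \<times> 3\<close> matrices over the field
  with two elements (type \<^typ>\<open>bit\<close>), with rows and columns numbered from \<open>0\<close>.
  Matrices act on row vectors from the right. Note that the products of blocks have to be
  formed with \<open>**\<close>, because \<open>*\<close> and \<open>^\<close> on \<^typ>\<open>bit^3^3\<close> are not the matrix operations.\<close>

type_synonym blk = "bit^3^3"
type_synonym blkmat = "nat \<Rightarrow> nat \<Rightarrow> blk"

definition UT :: "blkmat monoid" where
  "UT =
     \<lparr>carrier = {A. (\<forall>i j. j < i \<longrightarrow> A i j = 0) \<and> (\<forall>i. A i i = mat 1) \<and>
                    (\<forall>i j. A (i + 3) (j + 3) = A i j)},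
      mult = (\<lambda>A B i j. \<Sum>l\<in>{i..j}. A i l ** B l j),
      one = (\<lambda>i j. if i = j then mat 1 else 0)\<rparr>"

definition blk_pow :: "blk \<Rightarrow> nat \<Rightarrow> blk" where
  "blk_pow A n = ((\<lambda>B. B ** A) ^^ n) (mat 1)"

text \<open>
  The representation is the adjoint action on the cyclic algebra of Cartwright, Mantero, Steger
  and Zappa. Let \<open>K\<close> be the field with 8 elements, \<open>\<zeta> \<in> K\<close> with \<open>\<zeta>\<^sup>3 = \<zeta> + 1\<close>, let \<open>\<phi>\<close>
  be the Frobenius automorphism \<open>a \<mapsto> a\<^sup>2\<close>, and let \<open>K[[\<tau>]]\<close> be the ring of skew power series
  with \<open>\<tau> a = \<phi>(a) \<tau>\<close>; \<open>\<tau>\<^sup>3\<close> is central. For \<open>b\<^sub>i = 1 + \<zeta>\<^sup>i \<tau>\<close> one computes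
  \<open>b\<^sub>i b\<^sub>i\<^sub>+\<^sub>1 b\<^sub>i\<^sub>+\<^sub>3 = 1 + \<tau>\<^sup>3\<close>, which is central, so that \<open>x\<^sub>i \<mapsto> (y \<mapsto> b\<^sub>i\<inverse> y b\<^sub>i)\<close> defines
  a (right) action of the presented group. Its matrix with respect to the decomposition of
  \<open>K[[\<tau>]]\<close> into the three-dimensional pieces \<open>K \<tau>\<^sup>m\<close> has identity diagonal blocks, is
  3-periodic along the diagonals, and since \<open>b\<^sub>i\<inverse>\<close> is the sum of all \<open>\<zeta>^(i (2^n - 1)) \<tau>^n\<close>,
  its block in position \<open>(m, m + d)\<close> for \<open>d > 0\<close> is
  \<open>a \<mapsto> \<phi>^d(a) \<zeta>^(i (2^d - 1)) + \<phi>^(d-1)(a) \<zeta>^(i (2^(d-1) - 1 + 2^(m+d-1)))\<close>.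
  The rows of \<open>mul_zeta\<close> and \<open>frob\<close> are the images of \<open>1, \<zeta>, \<zeta>\<^sup>2\<close> in the basis \<open>1, \<zeta>, \<zeta>\<^sup>2\<close>.\<close>

definition mul_zeta :: blk where
  "mul_zeta = vector [vector [0, 1, 0], vector [0, 0, 1], vector [1, 1, 0]]"

definition frob :: blk where
  "frob = vector [vector [1, 0, 0], vector [0, 0, 1], vector [0, 1, 1]]"

definition gen_mat :: "nat \<Rightarrow> blkmat" where
  "gen_mat i = (\<lambda>m n.
     if n < m then 0
     else if n = m then mat 1
     else let d = n - m in
       blk_pow frob d ** blk_pow mul_zeta (i * (2 ^ d - 1)) +
       blk_pow frob (d - 1) ** blk_pow mul_zeta (i * (2 ^ (d - 1) - 1 + 2 ^ (n - 1))))"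

definition letter_mat :: "nat \<times> bool \<Rightarrow> blkmat" where
  "letter_mat l = (if snd l then gen_mat (fst l) else inv\<^bsub>UT\<^esub> (gen_mat (fst l)))"

definition word_mat :: "nat gword \<Rightarrow> blkmat" where
  "word_mat w = foldr (\<lambda>l M. letter_mat l \<otimes>\<^bsub>UT\<^esub> M) w \<one>\<^bsub>UT\<^esub>"

text \<open>The relators are sent to the identity, so the choice of a representing word is immaterial.\<close>

definition rep :: "elt \<Rightarrow> blkmat" where
  "rep g = word_mat (SOME w. w \<in> g)"

definition Gup :: "nat \<Rightarrow> elt set" where
  "Gup k = {g \<in> carrier GG. \<forall>m d. 1 \<le> d \<and> d \<le> k \<longrightarrow> rep g m (m + d) = 0}"

definition Gquot :: "nat \<Rightarrow> elt set monoid" where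
  "Gquot k = GG Mod Gup k"

definition xq :: "nat \<Rightarrow> nat \<Rightarrow> elt set" where
  "xq k i = Gup k #>\<^bsub>GG\<^esub> xgen i"

definition Sq :: "nat \<Rightarrow> elt set set" where
  "Sq k = {xq k 0, inv\<^bsub>Gquot k\<^esub> xq k 0,
           xq k 1, inv\<^bsub>Gquot k\<^esub> xq k 1,
           xq k 3, inv\<^bsub>Gquot k\<^esub> xq k 3}"


section \<open>Graphs\<close>

record 'v ugraph =
  verts :: "'v set"
  edges :: "'v set set"

definition adj :: "'v ugraph \<Rightarrow> 'v \<Rightarrow> 'v \<Rightarrow> bool" where
  "adj \<Gamma> v w \<longleftrightarrow> v \<in> verts \<Gamma> \<and> w \<in> verts \<Gamma> \<and> {v, w} \<in> edges \<Gamma>"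

definition triangles :: "'v ugraph \<Rightarrow> 'v set set" where
  "triangles \<Gamma> =
     {D. D \<subseteq> verts \<Gamma> \<and> card D = 3 \<and> (\<forall>v\<in>D. \<forall>w\<in>D. v \<noteq> w \<longrightarrow> adj \<Gamma> v w)}"

definition cayley_graph :: "('g, 'm) monoid_scheme \<Rightarrow> 'g set \<Rightarrow> 'g ugraph" where
  "cayley_graph H S =
     \<lparr>verts = carrier H,
      edges = {{h, h \<otimes>\<^bsub>H\<^esub> s} | h s. h \<in> carrier H \<and> s \<in> S}\<rparr>"

text \<open>In the \<open>(\<Delta>-Y)\<close>-transform, \<open>Inl v\<close> is the old vertex \<open>v\<close> and
  \<open>Inr D\<close> is the vertex added for the triangle \<open>D\<close>.\<close>

definition delta_Y :: "'v ugraph \<Rightarrow> ('v + 'v set) ugraph" where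
  "delta_Y \<Gamma> =
     \<lparr>verts = Inl ` verts \<Gamma> \<union> Inr ` triangles \<Gamma>,
      edges =
        (\<lambda>e. Inl ` e) ` (edges \<Gamma> - {{v, w} | v w D. D \<in> triangles \<Gamma> \<and> v \<in> D \<and> w \<in> D \<and> v \<noteq> w})
        \<union> {{Inl v, Inr D} | v D. D \<in> triangles \<Gamma> \<and> v \<in> D}\<rparr>"

definition adj_op :: "'v ugraph \<Rightarrow> ('v \<Rightarrow> 'b::real_field) \<Rightarrow> 'v \<Rightarrow> 'b" where
  "adj_op \<Gamma> f v = (\<Sum>w | adj \<Gamma> v w. f w)"

text \<open>Functions on the vertices are total functions of which only the values on
  \<open>verts \<Gamma>\<close> matter. The type of values covers both real and complex functions.\<close>

definition eigenfunction :: "'v ugraph \<Rightarrow> real \<Rightarrow> ('v \<Rightarrow> 'b::real_field) \<Rightarrow> bool" where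
  "eigenfunction \<Gamma> \<nu> f \<longleftrightarrow>
     (\<exists>v\<in>verts \<Gamma>. f v \<noteq> 0) \<and> (\<forall>v\<in>verts \<Gamma>. adj_op \<Gamma> f v = of_real \<nu> * f v)"

definition Xgraph :: "nat \<Rightarrow> elt set ugraph" where
  "Xgraph k = cayley_graph (Gquot k) (Sq k)"

definition Tgraph :: "nat \<Rightarrow> (elt set + elt set set) ugraph" where
  "Tgraph k = delta_Y (Xgraph k)"

end

theory Submission
  imports Defs
begin

text \<open>
  In \<open>X\<^sub>k\<close> every edge lies in exactly one triangle and every vertex in exactly three. Hence
  \<open>T\<^sub>k\<close> is the incidence graph of vertices and triangles, and the square of its adjacency
  operator restricts to \<open>A + 3\<close> on the vertices of \<open>X\<^sub>k\<close>, where \<open>A\<close> is the adjacency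
  operator of \<open>X\<^sub>k\<close>. This gives all the eigenvalue equations.

  Two points need more. In (b) there is no eigenvalue \<open>\<mu> < -3\<close>, because \<open>A + 3\<close> is the
  Gram operator of the incidence relation. In (a) with eigenvalue \<open>0\<close>, the restriction of \<open>F\<close>
  could vanish; this is excluded because the incidence operator is right multiplication by
  \<open>1 + x\<^sub>0\<^sup>-\<^sup>1 + x\<^sub>3\<close> in the group ring of the finite 2-group \<open>G\<^sub>k\<close>. Its augmentation \<open>3\<close> is
  odd, so it is invertible modulo 2, hence injective in characteristic 0.

  The triangles of \<open>X\<^sub>k\<close> are determined in \<open>G\<^sub>2\<close>: modulo the second diagonal the images of
  \<open>x\<^sub>0, x\<^sub>1, x\<^sub>3\<close> are the three nonzero elements of a Klein four-group, and the squares of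
  \<open>x\<^sub>0, x\<^sub>1, x\<^sub>3\<close>, read off on the second diagonal, are linearly independent. The only products
  of three elements of \<open>S\<close> equal to \<open>1\<close> are therefore the cyclic rotations of
  \<open>x\<^sub>0 x\<^sub>1 x\<^sub>3\<close> and their inverses.
\<close>

section \<open>The eigenvalue correspondence\<close>

lemma (in vector_space) ex_linear_functional:
  assumes "x \<noteq> 0"
  shows "\<exists>g. Vector_Spaces.linear scale (*) g \<and> g x = 1"
proof -
  interpret S: vector_space "(*) :: 'a \<Rightarrow> 'a \<Rightarrow> 'a"
    by unfold_locales (auto simp: algebra_simps)
  interpret P: vector_space_pair scale "(*) :: 'a \<Rightarrow> 'a \<Rightarrow> 'a"
    by unfold_locales
  have "independent {x}"
    using assms by (simp add: dependent_single)
  from P.linear_independent_extend[OF this, of "\<lambda>_. 1"] show ?thesis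
    by auto
qed

text \<open>Turns an eigenfunction with values in any real field into a real-valued one with the
  same eigenvalue.\<close>

lemma ex_real_functional:
  fixes x :: "'b::real_vector"
  assumes "x \<noteq> 0"
  shows "\<exists>g :: 'b \<Rightarrow> real. linear g \<and> g x = 1"
  using real_vector.ex_linear_functional[OF assms]
  by (simp add: linear_def real_scaleR_def[abs_def])

text \<open>The field is viewed as a vector space over the rationals. Additivity is what carries the
  kernel equations over to rational values.\<close>

lemma ex_rat_functional:
  fixes x :: "'b::field_char_0"
  assumes "x \<noteq> 0"
  shows "\<exists>g :: 'b \<Rightarrow> rat. (\<forall>y z. g (y + z) = g y + g z) \<and> g x = 1"
proof -
  interpret vector_space "\<lambda>(q::rat) (y::'b). of_rat q * y"
    by unfold_locales (auto simp: algebra_simps of_rat_add of_rat_mult)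
  from ex_linear_functional[OF assms] obtain g
    where "Vector_Spaces.linear (\<lambda>(q::rat) (y::'b). of_rat q * y) (*) g" "g x = 1"
    by blast
  then show ?thesis
    by (auto simp: Vector_Spaces.linear_iff)
qed

text \<open>The incidence geometry behind the correspondence: triangles partition the edges, and the
  number three of triangles at a vertex becomes the shift in \<open>A + 3\<close>. The condition
  \<open>edge_in_triangle\<close> also rules out loops.\<close>

locale triangle_decomposition =
  fixes \<Gamma> :: "'v ugraph"
  assumes finite_verts: "finite (verts \<Gamma>)"
    and edge_in_triangle:
      "e \<in> edges \<Gamma> \<Longrightarrow> \<exists>D\<in>triangles \<Gamma>. \<exists>v\<in>D. \<exists>w\<in>D. v \<noteq> w \<and> e = {v, w}"
    and triangle_unique:
      "\<lbrakk>D \<in> triangles \<Gamma>; D' \<in> triangles \<Gamma>; {v, w} \<subseteq> D \<inter> D'; v \<noteq> w\<rbrakk> \<Longrightarrow> D = D'"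
    and card_triangles_at: "v \<in> verts \<Gamma> \<Longrightarrow> card {D \<in> triangles \<Gamma>. v \<in> D} = 3"
begin

lemma triangle_subset: "D \<in> triangles \<Gamma> \<Longrightarrow> D \<subseteq> verts \<Gamma>"
  by (simp add: triangles_def)

lemma finite_triangle: "D \<in> triangles \<Gamma> \<Longrightarrow> finite D"
  using triangle_subset finite_verts finite_subset by blast

lemma finite_triangles: "finite (triangles \<Gamma>)"
  using triangle_subset finite_verts by (meson Pow_iff finite_Pow_iff finite_subset subsetI)

lemma adj_iff_triangle: "adj \<Gamma> v w \<longleftrightarrow> v \<noteq> w \<and> (\<exists>D\<in>triangles \<Gamma>. v \<in> D \<and> w \<in> D)"
proof
  assume "adj \<Gamma> v w"
  then have "{v, w} \<in> edges \<Gamma>"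
    by (simp add: adj_def)
  from edge_in_triangle[OF this] show "v \<noteq> w \<and> (\<exists>D\<in>triangles \<Gamma>. v \<in> D \<and> w \<in> D)"
    by (auto simp: doubleton_eq_iff)
next
  assume "v \<noteq> w \<and> (\<exists>D\<in>triangles \<Gamma>. v \<in> D \<and> w \<in> D)"
  then show "adj \<Gamma> v w"
    unfolding triangles_def by blast
qed

lemma verts_delta_Y: "verts (delta_Y \<Gamma>) = Inl ` verts \<Gamma> \<union> Inr ` triangles \<Gamma>"
  by (simp add: delta_Y_def)

text \<open>Every old edge lies in a triangle and is removed, so the transform is bipartite between
  vertices and triangles.\<close>

lemma edges_delta_Y: "edges (delta_Y \<Gamma>) = {{Inl v, Inr D} | v D. D \<in> triangles \<Gamma> \<and> v \<in> D}"
proof -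
  have "edges \<Gamma> - {{v, w} | v w D. D \<in> triangles \<Gamma> \<and> v \<in> D \<and> w \<in> D \<and> v \<noteq> w} = {}"
    (is "_ - ?E = {}")
  proof -
    have "e \<in> ?E" if "e \<in> edges \<Gamma>" for e
      using edge_in_triangle[OF that] by blast
    then show ?thesis
      by (intro iffD2[OF Diff_eq_empty_iff] subsetI)
  qed
  then show ?thesis
    unfolding delta_Y_def by (simp only: ugraph.simps) simp
qed

lemma adj_delta_Y_Inl:
  "adj (delta_Y \<Gamma>) (Inl v) y \<longleftrightarrow> (\<exists>D\<in>triangles \<Gamma>. v \<in> D \<and> y = Inr D)"
  using triangle_subset
  by (auto simp: adj_def verts_delta_Y edges_delta_Y doubleton_eq_iff)

lemma adj_delta_Y_Inr:
  "adj (delta_Y \<Gamma>) (Inr D) y \<longleftrightarrow> D \<in> triangles \<Gamma> \<and> (\<exists>v\<in>D. y = Inl v)"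
  using triangle_subset
  by (auto simp: adj_def verts_delta_Y edges_delta_Y doubleton_eq_iff)

lemma adj_op_delta_Y_Inl:
  "adj_op (delta_Y \<Gamma>) F (Inl v) = (\<Sum>D | D \<in> triangles \<Gamma> \<and> v \<in> D. F (Inr D))"
proof -
  have "{y. adj (delta_Y \<Gamma>) (Inl v) y} = Inr ` {D \<in> triangles \<Gamma>. v \<in> D}"
    by (auto simp: adj_delta_Y_Inl)
  then show ?thesis
    by (simp add: adj_op_def sum.reindex)
qed

lemma adj_op_delta_Y_Inr:
  assumes "D \<in> triangles \<Gamma>"
  shows "adj_op (delta_Y \<Gamma>) F (Inr D) = (\<Sum>v\<in>D. F (Inl v))"
proof -
  have "{y. adj (delta_Y \<Gamma>) (Inr D) y} = Inl ` D"
    using assms by (auto simp: adj_delta_Y_Inr)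
  then show ?thesis
    by (simp add: adj_op_def sum.reindex)
qed

text \<open>Each of the three triangles at \<open>v\<close> contributes \<open>f v\<close> once. The
  rest runs over the neighbours of \<open>v\<close> without repetition, because two triangles at
  \<open>v\<close> share no further vertex.\<close>

lemma sum_triangles_at:
  assumes "v \<in> verts \<Gamma>"
  shows "(\<Sum>D | D \<in> triangles \<Gamma> \<and> v \<in> D. \<Sum>w\<in>D. f w) = adj_op \<Gamma> f v + 3 * f v"
proof -
  let ?T = "{D \<in> triangles \<Gamma>. v \<in> D}"
  have fin: "finite ?T"
    using finite_triangles by simp
  have "(\<Sum>D\<in>?T. \<Sum>w\<in>D. f w) = (\<Sum>D\<in>?T. f v + (\<Sum>w\<in>D - {v}. f w))"
    by (intro sum.cong refl) (auto simp: sum.remove finite_triangle)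
  also have "\<dots> = 3 * f v + (\<Sum>D\<in>?T. \<Sum>w\<in>D - {v}. f w)"
    using card_triangles_at[OF assms] by (simp add: sum.distrib)
  also have "(\<Sum>D\<in>?T. \<Sum>w\<in>D - {v}. f w) = (\<Sum>w\<in>(\<Union>D\<in>?T. D - {v}). f w)"
  proof (rule sum.UNION_disjoint[symmetric])
    show "\<forall>D\<in>?T. \<forall>D'\<in>?T. D \<noteq> D' \<longrightarrow> (D - {v}) \<inter> (D' - {v}) = {}"
      using triangle_unique by blast
  qed (use fin finite_triangle in auto)
  also have "(\<Union>D\<in>?T. D - {v}) = {w. adj \<Gamma> v w}"
    by (auto simp: adj_iff_triangle)
  finally show ?thesis
    by (simp add: adj_op_def)
qed

text \<open>Two steps in the incidence graph: the eigenvalue equation is used first at the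
  triangles, then at \<open>v\<close>.\<close>

lemma adj_op_delta_Y_square:
  assumes F: "eigenfunction (delta_Y \<Gamma>) \<nu> F" and v: "v \<in> verts \<Gamma>"
  shows "adj_op \<Gamma> (\<lambda>w. F (Inl w)) v = of_real (\<nu>\<^sup>2 - 3) * F (Inl v)"
proof -
  have "adj_op \<Gamma> (\<lambda>w. F (Inl w)) v + 3 * F (Inl v) =
      (\<Sum>D | D \<in> triangles \<Gamma> \<and> v \<in> D. of_real \<nu> * F (Inr D))"
    unfolding sum_triangles_at[OF v, of "\<lambda>w. F (Inl w)", symmetric]
  proof (intro sum.cong refl)
    fix D assume "D \<in> {D \<in> triangles \<Gamma>. v \<in> D}"
    then show "(\<Sum>w\<in>D. F (Inl w)) = of_real \<nu> * F (Inr D)"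
      using F adj_op_delta_Y_Inr[of D F] by (simp add: eigenfunction_def verts_delta_Y)
  qed
  also have "\<dots> = of_real \<nu> * adj_op (delta_Y \<Gamma>) F (Inl v)"
    by (simp add: adj_op_delta_Y_Inl sum_distrib_left)
  also have "\<dots> = of_real \<nu> * (of_real \<nu> * F (Inl v))"
    using F v by (simp add: eigenfunction_def verts_delta_Y)
  finally show ?thesis
    by (simp add: power2_eq_square algebra_simps)
qed

text \<open>If \<open>F\<close> vanished on the old vertices, its equations there would make all
  sums over the triangles at a vertex vanish, and \<open>inj\<close> would kill \<open>F\<close>
  altogether. This covers eigenvalue 0, where the equations at the triangles say nothing about the
  values on triangles.\<close>

lemma eigenfunction_of_delta_Y:
  assumes inj: "\<And>g :: 'v set \<Rightarrow> 'b::real_field.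
      \<lbrakk>\<And>v. v \<in> verts \<Gamma> \<Longrightarrow> (\<Sum>D | D \<in> triangles \<Gamma> \<and> v \<in> D. g D) = 0\<rbrakk>
        \<Longrightarrow> \<forall>D\<in>triangles \<Gamma>. g D = 0"
    and F: "eigenfunction (delta_Y \<Gamma>) \<nu> (F :: 'v + 'v set \<Rightarrow> 'b)"
  shows "eigenfunction \<Gamma> (\<nu>\<^sup>2 - 3) (\<lambda>v. F (Inl v))"
proof -
  have "\<exists>v\<in>verts \<Gamma>. F (Inl v) \<noteq> 0"
  proof (rule ccontr)
    assume "\<not> (\<exists>v\<in>verts \<Gamma>. F (Inl v) \<noteq> 0)"
    then have zero: "F (Inl v) = 0" if "v \<in> verts \<Gamma>" for v
      using that by blast
    have "(\<Sum>D | D \<in> triangles \<Gamma> \<and> v \<in> D. F (Inr D)) = 0" if "v \<in> verts \<Gamma>" for v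
      using F that zero adj_op_delta_Y_Inl[of F v] by (simp add: eigenfunction_def verts_delta_Y)
    from inj[OF this] zero F show False
      by (auto simp: eigenfunction_def verts_delta_Y)
  qed
  with adj_op_delta_Y_square[OF F] show ?thesis
    by (simp add: eigenfunction_def)
qed

text \<open>Exchanging the summation over incident pairs turns \<open>(\<mu> + 3) * |f|^2\<close>
  into the sum of the squared triangle sums.\<close>

lemma real_eigenvalue_ge:
  fixes f :: "'v \<Rightarrow> real"
  assumes "eigenfunction \<Gamma> \<mu> f"
  shows "\<mu> \<ge> -3"
proof -
  from assms obtain v0 where v0: "v0 \<in> verts \<Gamma>" "f v0 \<noteq> 0"
    by (auto simp: eigenfunction_def)
  have "(\<mu> + 3) * (\<Sum>v\<in>verts \<Gamma>. (f v)\<^sup>2) = (\<Sum>v\<in>verts \<Gamma>. f v * (adj_op \<Gamma> f v + 3 * f v))"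
    using assms unfolding sum_distrib_left
    by (intro sum.cong refl) (simp add: eigenfunction_def power2_eq_square algebra_simps)
  also have "\<dots> = (\<Sum>v\<in>verts \<Gamma>. \<Sum>D | D \<in> triangles \<Gamma> \<and> v \<in> D. f v * (\<Sum>w\<in>D. f w))"
    by (intro sum.cong refl) (simp add: sum_triangles_at[symmetric] sum_distrib_left)
  also have "\<dots> = (\<Sum>D\<in>triangles \<Gamma>. \<Sum>v | v \<in> verts \<Gamma> \<and> v \<in> D. f v * (\<Sum>w\<in>D. f w))"
    by (rule sum.swap_restrict[OF finite_verts finite_triangles])
  also have "\<dots> = (\<Sum>D\<in>triangles \<Gamma>. (\<Sum>w\<in>D. f w)\<^sup>2)"
  proof (intro sum.cong refl)
    fix D assume "D \<in> triangles \<Gamma>"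
    then have "{v. v \<in> verts \<Gamma> \<and> v \<in> D} = D"
      using triangle_subset by blast
    then show "(\<Sum>v | v \<in> verts \<Gamma> \<and> v \<in> D. f v * (\<Sum>w\<in>D. f w)) = (\<Sum>w\<in>D. f w)\<^sup>2"
      by (simp add: sum_distrib_right power2_eq_square)
  qed
  finally have "(\<mu> + 3) * (\<Sum>v\<in>verts \<Gamma>. (f v)\<^sup>2) \<ge> 0"
    by (simp add: sum_nonneg)
  moreover have "(\<Sum>v\<in>verts \<Gamma>. (f v)\<^sup>2) > 0"
    using v0 finite_verts by (intro sum_pos2[of _ v0]) auto
  ultimately show ?thesis
    by (simp add: zero_le_mult_iff)
qed

text \<open>A real-linear functional carries an eigenfunction with values in \<^typ>\<open>'b\<close> to a real one.\<close>

lemma eigenvalue_ge: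
  fixes f :: "'v \<Rightarrow> 'b::real_field"
  assumes f: "eigenfunction \<Gamma> \<mu> f"
  shows "\<mu> \<ge> -3"
proof -
  from f obtain v0 where v0: "v0 \<in> verts \<Gamma>" "f v0 \<noteq> 0"
    by (auto simp: eigenfunction_def)
  obtain g :: "'b \<Rightarrow> real" where g: "linear g" "g (f v0) = 1"
    using ex_real_functional[OF v0(2)] by blast
  have "adj_op \<Gamma> (\<lambda>v. g (f v)) v = \<mu> * g (f v)" if "v \<in> verts \<Gamma>" for v
  proof -
    have "adj_op \<Gamma> (\<lambda>v. g (f v)) v = g (adj_op \<Gamma> f v)"
      by (simp add: adj_op_def linear_sum[OF g(1)])
    also have "adj_op \<Gamma> f v = \<mu> *\<^sub>R f v"
      using f that by (simp add: eigenfunction_def scaleR_conv_of_real)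
    finally show ?thesis
      by (simp add: linear_cmul[OF g(1)])
  qed
  with v0 g(2) have "eigenfunction \<Gamma> \<mu> (\<lambda>v. g (f v))"
    by (auto simp: eigenfunction_def intro!: bexI[of _ v0])
  then show ?thesis
    by (rule real_eigenvalue_ge)
qed

text \<open>At a triangle the eigenvalue equation is the definition of the new value; at an old
  vertex it is \<open>sum_triangles_at\<close>. The sign \<open>\<epsilon>\<close> with square 1
  treats both functions at once.\<close>

lemma eigenfunction_delta_Y:
  fixes f :: "'v \<Rightarrow> 'b::real_field"
  assumes f: "eigenfunction \<Gamma> \<mu> f" and \<mu>: "\<mu> \<noteq> -3" and \<epsilon>: "\<epsilon> \<in> {1, -1::real}"
  shows "eigenfunction (delta_Y \<Gamma>) (\<epsilon> * sqrt (\<mu> + 3))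
    (case_sum f (\<lambda>D. of_real (\<epsilon> * (1 / sqrt (\<mu> + 3))) *
      (\<Sum>w | adj (delta_Y \<Gamma>) (Inr D) (Inl w). f w)))"
    (is "eigenfunction _ ?\<nu> ?F")
proof -
  \<comment> \<open>For a negative argument \<open>sqrt\<close> does not square back to it, and at 0
    the factor \<open>1 / sqrt\<close> degenerates to 0.\<close>
  have pos: "\<mu> + 3 > 0"
    using eigenvalue_ge[OF f] \<mu> by simp
  have \<epsilon>2: "\<epsilon> * \<epsilon> = 1"
    using \<epsilon> by auto
  have inv: "\<epsilon> * (1 / sqrt (\<mu> + 3)) * (\<mu> + 3) = ?\<nu>" "?\<nu> * (\<epsilon> * (1 / sqrt (\<mu> + 3))) = 1"
    using pos \<epsilon>2 by (auto simp: field_simps)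
  have Inr: "?F (Inr D) = of_real (\<epsilon> * (1 / sqrt (\<mu> + 3))) * (\<Sum>w\<in>D. f w)"
    if "D \<in> triangles \<Gamma>" for D
  proof -
    have "{w. adj (delta_Y \<Gamma>) (Inr D) (Inl w)} = D"
      using that by (auto simp: adj_delta_Y_Inr)
    then show ?thesis
      by simp
  qed
  have "adj_op (delta_Y \<Gamma>) ?F (Inl v) = of_real ?\<nu> * ?F (Inl v)" if v: "v \<in> verts \<Gamma>" for v
  proof -
    have "adj_op (delta_Y \<Gamma>) ?F (Inl v) = (\<Sum>D | D \<in> triangles \<Gamma> \<and> v \<in> D.
        of_real (\<epsilon> * (1 / sqrt (\<mu> + 3))) * (\<Sum>w\<in>D. f w))"
      unfolding adj_op_delta_Y_Inl by (intro sum.cong refl Inr) simp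
    also have "\<dots> = of_real (\<epsilon> * (1 / sqrt (\<mu> + 3))) * (adj_op \<Gamma> f v + 3 * f v)"
      by (simp add: sum_triangles_at[OF v, symmetric] sum_distrib_left)
    also have "adj_op \<Gamma> f v + 3 * f v = of_real (\<mu> + 3) * f v"
      using f v by (simp add: eigenfunction_def algebra_simps)
    finally show ?thesis
      by (simp only: mult.assoc[symmetric] of_real_mult[symmetric] inv sum.case)
  qed
  moreover have "adj_op (delta_Y \<Gamma>) ?F (Inr D) = of_real ?\<nu> * ?F (Inr D)"
    if D: "D \<in> triangles \<Gamma>" for D
  proof -
    have "of_real ?\<nu> * ?F (Inr D) = of_real (?\<nu> * (\<epsilon> * (1 / sqrt (\<mu> + 3)))) * (\<Sum>w\<in>D. f w)"
      unfolding Inr[OF D] by (simp only: mult.assoc of_real_mult)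
    then show ?thesis
      unfolding inv(2) by (simp only: adj_op_delta_Y_Inr[OF D] sum.case of_real_1 mult_1_left)
  qed
  moreover have "\<exists>v\<in>verts (delta_Y \<Gamma>). ?F v \<noteq> 0"
    using f by (auto simp: eigenfunction_def verts_delta_Y intro!: bexI[of _ "Inl _"])
  ultimately show ?thesis
    unfolding eigenfunction_def by (auto simp only: verts_delta_Y)
qed

text \<open>At old vertices both sides are 0, since all neighbours are triangles; the equations at
  the triangles are the triangle sums.\<close>

lemma eigenfunction_delta_Y_zero_iff:
  fixes f :: "'v \<Rightarrow> 'b::real_field"
  assumes "eigenfunction \<Gamma> \<mu> f"
  shows "eigenfunction (delta_Y \<Gamma>) 0 (case_sum f (\<lambda>_. 0)) \<longleftrightarrow>
    (\<forall>D\<in>triangles \<Gamma>. (\<Sum>v\<in>D. f v) = 0)"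
proof -
  have "adj_op (delta_Y \<Gamma>) (case_sum f (\<lambda>_. 0)) (Inl v) = 0" for v
    by (simp add: adj_op_delta_Y_Inl)
  moreover have "\<exists>v\<in>verts (delta_Y \<Gamma>). case_sum f (\<lambda>_. 0) v \<noteq> 0"
    using assms by (auto simp: eigenfunction_def verts_delta_Y intro!: bexI[of _ "Inl _"])
  moreover have "adj_op (delta_Y \<Gamma>) (case_sum f (\<lambda>_. 0)) (Inr D) = (\<Sum>v\<in>D. f v)"
    if "D \<in> triangles \<Gamma>" for D
    using that by (simp add: adj_op_delta_Y_Inr)
  ultimately show ?thesis
    by (simp add: eigenfunction_def verts_delta_Y ball_Un)
qed

end

section \<open>Injectivity over finite 2-groups\<close>

text \<open>\<open>N\<close> plays the role of a central series with elementary abelian quotients. The kernel of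
  \<open>1 + a + b\<close> over the field with two elements then contains, if it is nonzero, a nonzero
  translation invariant function, which is absurd since \<open>1 + 1 + 1 \<noteq> 0\<close>.\<close>

locale elementary_central_series = group H for H (structure) +
  fixes N :: "nat \<Rightarrow> 'a set" and k :: nat
  assumes finite_carrier: "finite (carrier H)"
    and series_subset: "N j \<subseteq> carrier H"
    and series_0: "N 0 = carrier H"
    and series_k: "N k = {\<one>}"
    and series_square: "z \<in> N j \<Longrightarrow> z \<otimes> z \<in> N (Suc j)"
    and series_commute: "\<lbrakk>z \<in> N j; s \<in> carrier H\<rbrakk> \<Longrightarrow> \<exists>c\<in>N (Suc j). z \<otimes> s = c \<otimes> (s \<otimes> z)"
begin

text \<open>The kernel of \<open>1 + a + b\<close>, acting by right translations.\<close>

definition ker_bit :: "'a \<Rightarrow> 'a \<Rightarrow> ('a \<Rightarrow> bit) set" where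
  "ker_bit a b = {f. \<forall>h\<in>carrier H. f h + f (h \<otimes> a) + f (h \<otimes> b) = 0}"

text \<open>Left translations commute with the right translations in \<open>ker_bit\<close>, so that
  kernel is stable under them.\<close>

definition left_inv :: "'a \<Rightarrow> ('a \<Rightarrow> bit) \<Rightarrow> bool" where
  "left_inv z f \<longleftrightarrow> (\<forall>h\<in>carrier H. f (z \<otimes> h) = f h)"

lemma series_carrier: "z \<in> N j \<Longrightarrow> z \<in> carrier H"
  using series_subset by blast

text \<open>Invariance under \<open>N j\<close> is acquired one element at a time. Modulo
  \<open>N (Suc j)\<close>, which acts trivially on \<open>g\<close>, an element \<open>z\<close> of
  \<open>N j\<close> is central with square 1; if \<open>g\<close> is not yet fixed by
  \<open>z\<close>, it is replaced by \<open>(1 + z) g\<close>.\<close>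

lemma ex_invariant_step:
  assumes ab: "a \<in> carrier H" "b \<in> carrier H"
    and f: "f \<in> ker_bit a b" "\<forall>c\<in>N (Suc j). left_inv c f" "\<exists>h\<in>carrier H. f h \<noteq> 0"
    and Z: "Z \<subseteq> N j" "finite Z"
  shows "\<exists>g\<in>ker_bit a b. (\<forall>c\<in>N (Suc j). left_inv c g) \<and> (\<exists>h\<in>carrier H. g h \<noteq> 0)
    \<and> (\<forall>z\<in>Z. left_inv z g)"
  using Z(2,1)
proof (induction Z)
  case empty
  then show ?case
    using f by auto
next
  case (insert z Z)
  then obtain g where g: "g \<in> ker_bit a b" "\<And>c. c \<in> N (Suc j) \<Longrightarrow> left_inv c g"
      "\<exists>h\<in>carrier H. g h \<noteq> 0" "\<And>z. z \<in> Z \<Longrightarrow> left_inv z g"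
    by auto
  have z: "z \<in> N j" "z \<in> carrier H"
    using insert.prems series_carrier by auto
  show ?case
  proof (cases "left_inv z g")
    case True
    with g show ?thesis
      by auto
  next
    case False
    \<comment> \<open>In characteristic 2, \<open>(1 + z)^2 = 1 + z^2\<close> annihilates
      \<open>g\<close>, so \<open>g'\<close> is fixed by \<open>z\<close>.\<close>
    define g' where "g' h = g h + g (z \<otimes> h)" for h
    have comm: "g (z \<otimes> (w \<otimes> h)) = g (w \<otimes> (z \<otimes> h))" if wh: "w \<in> carrier H" "h \<in> carrier H" for w h
    proof -
      obtain c where c: "c \<in> N (Suc j)" "z \<otimes> w = c \<otimes> (w \<otimes> z)"
        using series_commute[OF z(1) wh(1)] by auto
      have "z \<otimes> (w \<otimes> h) = (z \<otimes> w) \<otimes> h"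
        using z wh by (simp add: m_assoc)
      also have "\<dots> = c \<otimes> (w \<otimes> (z \<otimes> h))"
        using c z wh series_carrier[OF c(1)] by (simp add: m_assoc)
      finally show ?thesis
        using g(2)[OF c(1)] z wh by (simp add: left_inv_def)
    qed
    have inv: "left_inv w g'" if "w \<in> carrier H" "left_inv w g" for w
      using that comm z by (auto simp: left_inv_def g'_def)
    have "left_inv z g'"
      unfolding left_inv_def
    proof
      fix h assume h: "h \<in> carrier H"
      have "z \<otimes> (z \<otimes> h) = (z \<otimes> z) \<otimes> h"
        using h z by (simp add: m_assoc)
      then have "g (z \<otimes> (z \<otimes> h)) = g h"
        using g(2)[OF series_square[OF z(1)]] h by (simp add: left_inv_def)
      then show "g' (z \<otimes> h) = g' h"
        by (simp add: g'_def add.commute del: add_bit_eq_xor)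
    qed
    moreover have "g' \<in> ker_bit a b"
    proof -
      have "g' h + g' (h \<otimes> a) + g' (h \<otimes> b) = 0" if h: "h \<in> carrier H" for h
      proof -
        have "g' h + g' (h \<otimes> a) + g' (h \<otimes> b) =
            (g h + g (h \<otimes> a) + g (h \<otimes> b)) +
            (g (z \<otimes> h) + g (z \<otimes> h \<otimes> a) + g (z \<otimes> h \<otimes> b))"
          using h z ab by (simp add: g'_def m_assoc algebra_simps del: add_bit_eq_xor)
        then show ?thesis
          using g(1) h z by (simp add: ker_bit_def del: add_bit_eq_xor)
      qed
      then show ?thesis
        by (simp add: ker_bit_def)
    qed
    moreover have "\<exists>h\<in>carrier H. g' h \<noteq> 0"
    proof -
      obtain h where "h \<in> carrier H" "g (z \<otimes> h) \<noteq> g h"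
        using False by (auto simp: left_inv_def)
      then have "g' h \<noteq> 0"
        by (cases "g h"; cases "g (z \<otimes> h)") (auto simp: g'_def)
      with \<open>h \<in> carrier H\<close> show ?thesis
        by blast
    qed
    ultimately show ?thesis
      using g inv series_carrier insert.prems by (intro bexI[of _ g']) auto
  qed
qed

lemma ker_bit_trivial:
  assumes ab: "a \<in> carrier H" "b \<in> carrier H"
    and f: "f \<in> ker_bit a b" and h: "h \<in> carrier H"
  shows "f h = 0"
proof (rule ccontr)
  assume nz: "f h \<noteq> 0"
  \<comment> \<open>The induction climbs from the trivial group \<open>N k\<close> to
    \<open>N 0\<close>, the whole group.\<close>
  have "\<exists>g\<in>ker_bit a b. (\<forall>c\<in>N (k - i). left_inv c g) \<and> (\<exists>h\<in>carrier H. g h \<noteq> 0)"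
    if "i \<le> k" for i
    using that
  proof (induction i)
    case 0
    have "left_inv \<one> f"
      by (simp add: left_inv_def)
    with f nz h show ?case
      by (auto simp: series_k)
  next
    case (Suc i)
    then obtain g where g: "g \<in> ker_bit a b" "\<forall>c\<in>N (Suc (k - Suc i)). left_inv c g"
        "\<exists>h\<in>carrier H. g h \<noteq> 0"
      by (auto simp: Suc_diff_Suc)
    have "finite (N (k - Suc i))"
      using finite_carrier series_subset finite_subset by blast
    from ex_invariant_step[OF ab g subset_refl this] show ?case
      by auto
  qed
  from this[of k] obtain g where g: "g \<in> ker_bit a b" "\<And>c. c \<in> carrier H \<Longrightarrow> left_inv c g"
      "\<exists>h\<in>carrier H. g h \<noteq> 0"
    by (auto simp: series_0)
  have const: "g h = g \<one>" if "h \<in> carrier H" for h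
    using g(2)[OF that] that by (auto simp: left_inv_def dest!: bspec[of _ _ \<one>])
  \<comment> \<open>For a constant function the kernel equation is three times the constant, which
    is the constant itself in characteristic 2.\<close>
  have "g \<one> + g \<one> + g \<one> = 0"
    using g(1) const[OF ab(1)] const[OF ab(2)] ab
    by (auto simp: ker_bit_def dest!: bspec[of _ _ \<one>])
  then have "g \<one> = 0"
    by (cases "g \<one>") auto
  with g(3) const show False
    by auto
qed

text \<open>Descent at 2: reduction modulo 2 shows that all values are even, and halving stays in
  the kernel, so every value is divisible by all powers of 2.\<close>

lemma ker_int_trivial:
  fixes f :: "'a \<Rightarrow> int"
  assumes ab: "a \<in> carrier H" "b \<in> carrier H"
    and f: "\<And>h. h \<in> carrier H \<Longrightarrow> f h + f (h \<otimes> a) + f (h \<otimes> b) = 0"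
    and h: "h \<in> carrier H"
  shows "f h = 0"
proof -
  have "2 ^ n dvd f h" if "\<And>h. h \<in> carrier H \<Longrightarrow> f h + f (h \<otimes> a) + f (h \<otimes> b) = 0"
    for n and f :: "'a \<Rightarrow> int"
    using that
  proof (induction n arbitrary: f)
    case (Suc n)
    have "(\<lambda>h. of_int (f h)) \<in> ker_bit a b"
      unfolding ker_bit_def
    proof (intro CollectI ballI)
      fix h assume "h \<in> carrier H"
      from arg_cong[OF Suc.prems[OF this], of "of_int :: int \<Rightarrow> bit"]
      show "of_int (f h) + of_int (f (h \<otimes> a)) + of_int (f (h \<otimes> b)) = (0::bit)"
        by (simp del: add_bit_eq_xor)
    qed
    from ker_bit_trivial[OF ab this] have even: "even (f h)" if "h \<in> carrier H" for h
      using that by (metis even_of_int_iff even_zero)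
    have "2 ^ n dvd (f h div 2)"
    proof (rule Suc.IH)
      fix h assume h: "h \<in> carrier H"
      then have "even (f h)" "even (f (h \<otimes> a))" "even (f (h \<otimes> b))"
        using even ab by auto
      then show "f h div 2 + f (h \<otimes> a) div 2 + f (h \<otimes> b) div 2 = 0"
        using Suc.prems[OF h] by presburger
    qed
    then have "2 * 2 ^ n dvd 2 * (f h div 2)"
      by (rule mult_dvd_mono[OF dvd_refl])
    then show ?case
      using even[OF h] by simp
  qed simp
  \<comment> \<open>This exponent is large enough because \<open>n < 2 ^ n\<close>.\<close>
  from this[OF f, of "nat \<bar>f h\<bar>"] show ?thesis
  proof (rule contrapos_pp)
    assume "f h \<noteq> 0"
    moreover have "\<bar>f h\<bar> < 2 ^ nat \<bar>f h\<bar>"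
      by (metis less_exp nat_abs_int_diff nat_less_iff abs_ge_zero of_nat_less_two_power nat_0_le)
    ultimately show "\<not> 2 ^ nat \<bar>f h\<bar> dvd f h"
      using zdvd_not_zless[of "\<bar>f h\<bar>" "2 ^ nat \<bar>f h\<bar>"] by simp
  qed
qed

text \<open>A rational functional that is nonzero at \<open>f h\<close> and a common denominator
  reduce the claim to the integers.\<close>

lemma ker_trivial:
  fixes f :: "'a \<Rightarrow> 'c::field_char_0"
  assumes ab: "a \<in> carrier H" "b \<in> carrier H"
    and f: "\<And>h. h \<in> carrier H \<Longrightarrow> f h + f (h \<otimes> a) + f (h \<otimes> b) = 0"
    and h: "h \<in> carrier H"
  shows "f h = 0"
proof (rule ccontr)
  assume "f h \<noteq> 0"
  then obtain \<phi> :: "'c \<Rightarrow> rat" where \<phi>: "\<And>y z. \<phi> (y + z) = \<phi> y + \<phi> z" "\<phi> (f h) = 1"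
    using ex_rat_functional by blast
  have \<phi>0: "\<phi> 0 = 0"
    using \<phi>(1)[of 0 0] by simp
  define q where "q x = snd (quotient_of (\<phi> (f x)))" for x
  have q: "q x > 0" for x
    by (simp add: q_def quotient_of_denom_pos')
  have num: "of_int (q x) * \<phi> (f x) = of_int (fst (quotient_of (\<phi> (f x))))" for x
  proof -
    have gen: "of_int d * r = of_int n" if "r = of_int n / of_int d" "d > 0" for r :: rat and n d
      using that by simp
    show ?thesis
      by (rule gen[OF quotient_of_div q]) (simp add: q_def)
  qed
  \<comment> \<open>\<open>Q\<close> is the product of all denominators. The denominator belonging
    to \<open>x\<close> cancels, so \<open>Q * \<phi> (f x)\<close> is the integer
    \<open>g x\<close>.\<close>
  define Q where "Q = prod q (carrier H)"
  define g where "g x = prod q (carrier H - {x}) * fst (quotient_of (\<phi> (f x)))" for x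
  have g: "of_int (g x) = of_int Q * \<phi> (f x)" if "x \<in> carrier H" for x
    using num[of x, symmetric] prod.remove[OF finite_carrier that, of q]
    by (simp add: g_def Q_def)
  have "g h = 0"
  proof (rule ker_int_trivial[OF ab _ h])
    fix x assume x: "x \<in> carrier H"
    have "(of_int (g x + g (x \<otimes> a) + g (x \<otimes> b)) :: rat) =
        of_int Q * \<phi> (f x + f (x \<otimes> a) + f (x \<otimes> b))"
      using x ab by (simp add: g \<phi>(1) distrib_left)
    then show "g x + g (x \<otimes> a) + g (x \<otimes> b) = 0"
      unfolding f[OF x] \<phi>0 by (simp only: mult_zero_right of_int_eq_0_iff)
  qed
  moreover have "Q \<noteq> 0"
    using q finite_carrier by (auto simp: Q_def) (metis less_irrefl)
  ultimately show False
    using g[OF h] \<phi>(2) by simp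
qed

end

section \<open>Cayley graphs of triangle groups\<close>

text \<open>Three triangles with common vertex \<open>v\<close> and six distinct outer vertices: the
  picture at a vertex of the Cayley graph.\<close>

lemma distinct_windmill:
  assumes "distinct [v, p, p', q, q', r, r']"
  shows "distinct [{v, p, r'}, {v, p', q}, {v, r, q'}]"
proof -
  have "p \<notin> {v, p', q}" "p \<notin> {v, r, q'}" "p' \<notin> {v, r, q'}"
    using assms by auto
  then show ?thesis
    by auto
qed

lemma windmill_unique:
  assumes "distinct [v, p, p', q, q', r, r']"
    and "D \<in> {{v, p, r'}, {v, p', q}, {v, r, q'}}" "D' \<in> {{v, p, r'}, {v, p', q}, {v, r, q'}}"
    and "w \<in> D" "w \<in> D'" "w \<noteq> v"
  shows "D = D'"
  using assms by auto

text \<open>The facts on the quotients that determine the graph: \<open>distinct_gens\<close> gives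
  six distinct neighbours, and \<open>product_one\<close> says that closed walks of length three
  come from the relator alone.\<close>

locale triangle_group = group H for H (structure) +
  fixes a b c :: 'a and S :: "'a set"
  assumes S_def: "S = {a, inv a, b, inv b, c, inv c}"
    and finite_group: "finite (carrier H)"
    and closed: "a \<in> carrier H" "b \<in> carrier H" "c \<in> carrier H"
    and relation: "a \<otimes> b \<otimes> c = \<one>"
    and distinct_gens: "distinct [\<one>, a, inv a, b, inv b, c, inv c]"
    and product_one: "\<lbrakk>s \<in> S; u \<in> S; t \<in> S; s \<otimes> u \<otimes> t = \<one>\<rbrakk> \<Longrightarrow>
      (s, u, t) \<in> {(a, b, c), (b, c, a), (c, a, b),
        (inv c, inv b, inv a), (inv b, inv a, inv c), (inv a, inv c, inv b)}"
begin

text \<open>The third vertex is \<open>h \<otimes> a \<otimes> b\<close>, rewritten by the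
  relation.\<close>

definition tri :: "'a \<Rightarrow> 'a set" where
  "tri h = {h, h \<otimes> a, h \<otimes> inv c}"

abbreviation "\<Gamma> \<equiv> cayley_graph H S"

lemma S_closed: "s \<in> S \<Longrightarrow> s \<in> carrier H"
  using closed by (auto simp: S_def)

lemma S_inv: "s \<in> S \<Longrightarrow> inv s \<in> S"
  using closed by (auto simp: S_def)

lemma one_notin_S: "\<one> \<notin> S"
  using distinct_gens by (auto simp: S_def)

lemma relation_products:
  "a \<otimes> b = inv c" "b \<otimes> c = inv a" "c \<otimes> a = inv b"
  "inv c \<otimes> inv b = a" "inv b \<otimes> inv a = c" "inv a \<otimes> inv c = b"
proof -
  show ab: "a \<otimes> b = inv c"
    using relation closed by (simp add: inv_equality)
  have "a \<otimes> (b \<otimes> c) = \<one>"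
    using relation closed by (simp add: m_assoc)
  then show bc: "b \<otimes> c = inv a"
    using closed by (metis inv_equality inv_inv m_closed)
  have "c \<otimes> a \<otimes> b = \<one>"
    using ab closed by (simp add: m_assoc)
  then show "c \<otimes> a = inv b"
    using closed by (simp add: inv_equality)
  from this[symmetric] show "inv b \<otimes> inv a = c"
    using closed by (simp add: m_assoc)
  from ab[symmetric] show "inv c \<otimes> inv b = a"
    using closed by (simp add: m_assoc)
  from bc[symmetric] show "inv a \<otimes> inv c = b"
    using closed by (simp add: m_assoc)
qed

text \<open>The triangles in which \<open>v\<close> is the second or the third vertex, as
  \<open>v = (v \<otimes> inv a) \<otimes> a\<close> and
  \<open>v = (v \<otimes> c) \<otimes> inv c\<close>.\<close>

lemma tri_translates:
  assumes "v \<in> carrier H"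
  shows "tri (v \<otimes> inv a) = {v, v \<otimes> inv a, v \<otimes> b}" "tri (v \<otimes> c) = {v, v \<otimes> c, v \<otimes> inv b}"
  using assms closed relation_products by (auto simp: tri_def m_assoc)

lemma verts_cayley: "verts \<Gamma> = carrier H"
  by (simp add: cayley_graph_def)

lemma adj_cayley: "adj \<Gamma> v w \<longleftrightarrow> v \<in> carrier H \<and> (\<exists>s\<in>S. w = v \<otimes> s)"
proof
  assume adj: "adj \<Gamma> v w"
  then obtain h s where hs: "h \<in> carrier H" "s \<in> S" "{v, w} = {h, h \<otimes> s}"
    by (auto simp: adj_def cayley_graph_def)
  then consider "v = h" "w = h \<otimes> s" | "w = h" "v = h \<otimes> s"
    by (auto simp: doubleton_eq_iff)
  then show "v \<in> carrier H \<and> (\<exists>s\<in>S. w = v \<otimes> s)"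
  proof cases
    case 1
    then show ?thesis
      using hs by auto
  next
    case 2
    then have "w = v \<otimes> inv s"
      using hs S_closed by (simp add: m_assoc)
    then show ?thesis
      using 2 hs S_closed S_inv by auto
  qed
next
  assume "v \<in> carrier H \<and> (\<exists>s\<in>S. w = v \<otimes> s)"
  then show "adj \<Gamma> v w"
    using S_closed by (auto simp: adj_def cayley_graph_def)
qed

lemma adj_sym: "adj \<Gamma> v w \<Longrightarrow> adj \<Gamma> w v"
  by (simp add: adj_def insert_commute)

lemma translates_distinct:
  assumes "v \<in> carrier H"
  shows "distinct [v, v \<otimes> a, v \<otimes> inv a, v \<otimes> b, v \<otimes> inv b, v \<otimes> c, v \<otimes> inv c]"
proof -
  have "distinct (map (\<lambda>x. v \<otimes> x) [\<one>, a, inv a, b, inv b, c, inv c])"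
    unfolding distinct_map
    using distinct_gens assms closed by (auto intro!: inj_onI)
  then show ?thesis
    using assms by simp
qed

lemma tri_triangle:
  assumes "v \<in> carrier H"
  shows "tri v \<in> triangles \<Gamma>"
proof -
  have adj: "adj \<Gamma> v (v \<otimes> a)" "adj \<Gamma> v (v \<otimes> inv c)"
    unfolding adj_cayley using assms by (auto simp: S_def)
  have "v \<otimes> inv c = v \<otimes> a \<otimes> b"
    using assms closed relation_products by (simp add: m_assoc)
  moreover have "adj \<Gamma> (v \<otimes> a) (v \<otimes> a \<otimes> b)"
    unfolding adj_cayley using assms closed by (auto simp: S_def)
  ultimately have "adj \<Gamma> (v \<otimes> a) (v \<otimes> inv c)"
    by simp
  note adj = adj this
  have "adj \<Gamma> x y" if "x \<in> tri v" "y \<in> tri v" "x \<noteq> y" for x y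
    using that adj adj[THEN adj_sym] unfolding tri_def by (elim insertE emptyE) simp_all
  moreover have "card (tri v) = 3"
    unfolding tri_def using translates_distinct[OF assms] by (simp add: card_insert_if)
  ultimately show ?thesis
    using assms closed by (auto simp: triangles_def verts_cayley tri_def)
qed

text \<open>A triangle with vertices \<open>v\<close>, \<open>v \<otimes> s\<close>,
  \<open>v \<otimes> t\<close> gives a closed walk with labels \<open>s\<close>, \<open>u\<close>,
  \<open>inv t\<close>. The six label triples allowed by \<open>product_one\<close> describe each of
  the three triangles twice, once per orientation.\<close>

lemma triangles_at:
  assumes v: "v \<in> carrier H"
  shows "{D \<in> triangles \<Gamma>. v \<in> D} = {tri v, tri (v \<otimes> inv a), tri (v \<otimes> c)}"
proof
  show "{D \<in> triangles \<Gamma>. v \<in> D} \<subseteq> {tri v, tri (v \<otimes> inv a), tri (v \<otimes> c)}"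
  proof
    fix D assume "D \<in> {D \<in> triangles \<Gamma>. v \<in> D}"
    then have D: "card D = 3" "v \<in> D"
        "\<And>x y. \<lbrakk>x \<in> D; y \<in> D; x \<noteq> y\<rbrakk> \<Longrightarrow> adj \<Gamma> x y"
      by (auto simp: triangles_def)
    then have "card (D - {v}) = 2"
      by simp
    then obtain p q where pq: "D - {v} = {p, q}" "p \<noteq> q"
      by (auto simp: card_2_iff)
    then have Deq: "D = {v, p, q}"
      using D(2) by blast
    have "v \<noteq> p" "v \<noteq> q"
      using pq by auto
    with pq(2) D(3) Deq obtain s t u where
      s: "s \<in> S" "p = v \<otimes> s" and t: "t \<in> S" "q = v \<otimes> t" and u: "u \<in> S" "q = p \<otimes> u"
      unfolding adj_cayley by (metis insertCI)
    note carr = S_closed[OF s(1)] S_closed[OF t(1)] S_closed[OF u(1)]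
    have "v \<otimes> (s \<otimes> u) = v \<otimes> t"
      using s t u v carr by (simp add: m_assoc)
    then have "s \<otimes> u = t"
      using v carr by simp
    then have "s \<otimes> u \<otimes> inv t = \<one>"
      using carr by simp
    from product_one[OF s(1) u(1) S_inv[OF t(1)] this]
    have "(s, inv t) \<in> {(a, c), (b, a), (c, b), (inv c, inv a), (inv b, inv c), (inv a, inv b)}"
      by auto
    then have "(s, t) \<in> {(a, inv c), (b, inv a), (c, inv b), (inv c, a), (inv b, c), (inv a, b)}"
      using carr closed by (auto dest!: arg_cong[where f = "\<lambda>x. inv x" and x = "inv t"])
    then show "D \<in> {tri v, tri (v \<otimes> inv a), tri (v \<otimes> c)}"
      unfolding tri_translates[OF v] Deq s t by (auto simp: tri_def)
  qed
  show "{tri v, tri (v \<otimes> inv a), tri (v \<otimes> c)} \<subseteq> {D \<in> triangles \<Gamma>. v \<in> D}"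
  proof -
    have "v \<in> tri v" "v \<in> tri (v \<otimes> inv a)" "v \<in> tri (v \<otimes> c)"
      unfolding tri_translates[OF v] by (auto simp: tri_def)
    then show ?thesis
      using tri_triangle v closed by auto
  qed
qed

lemma tri_distinct:
  assumes "v \<in> carrier H"
  shows "distinct [tri v, tri (v \<otimes> inv a), tri (v \<otimes> c)]"
  using distinct_windmill[OF translates_distinct[OF assms]]
  unfolding tri_translates[OF assms] by (simp only: tri_def)

lemma triangle_is_tri: "D \<in> triangles \<Gamma> \<Longrightarrow> \<exists>v\<in>carrier H. D = tri v"
proof -
  assume D: "D \<in> triangles \<Gamma>"
  then have "D \<noteq> {}" "D \<subseteq> carrier H"
    by (auto simp: triangles_def verts_cayley)
  then obtain v where v: "v \<in> carrier H" "v \<in> D"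
    by blast
  with D triangles_at[OF v(1)] have "D \<in> {tri v, tri (v \<otimes> inv a), tri (v \<otimes> c)}"
    by blast
  then show ?thesis
    using v closed by auto
qed

text \<open>The triangles at \<open>v\<close> form a windmill whose outer vertices are the six
  neighbours of \<open>v\<close>; the conditions are read off from it.\<close>

sublocale triangle_decomposition \<Gamma>
proof
  show "finite (verts \<Gamma>)"
    by (simp add: verts_cayley finite_group)
next
  fix e assume "e \<in> edges \<Gamma>"
  then obtain v s where v: "v \<in> carrier H" and s: "s \<in> S" and e: "e = {v, v \<otimes> s}"
    by (auto simp: cayley_graph_def)
  have "v \<otimes> s \<in> \<Union> {tri v, tri (v \<otimes> inv a), tri (v \<otimes> c)}"
    using s unfolding tri_translates[OF v] unfolding tri_def S_def by (elim insertE emptyE) simp_all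
  then obtain D where "D \<in> triangles \<Gamma>" "v \<in> D" "v \<otimes> s \<in> D"
    unfolding triangles_at[OF v, symmetric] by blast
  moreover have "v \<noteq> v \<otimes> s"
  proof
    assume "v = v \<otimes> s"
    then have "s = \<one>"
      using v S_closed[OF s] by simp
    with s one_notin_S show False
      by simp
  qed
  ultimately show "\<exists>D\<in>triangles \<Gamma>. \<exists>v\<in>D. \<exists>w\<in>D. v \<noteq> w \<and> e = {v, w}"
    using e by blast
next
  fix D D' v w
  assume *: "D \<in> triangles \<Gamma>" "D' \<in> triangles \<Gamma>" "{v, w} \<subseteq> D \<inter> D'" "v \<noteq> w"
  then have v: "v \<in> carrier H"
    by (auto simp: triangles_def verts_cayley)
  have "D \<in> {tri v, tri (v \<otimes> inv a), tri (v \<otimes> c)}" "D' \<in> {tri v, tri (v \<otimes> inv a), tri (v \<otimes> c)}"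
    using * unfolding triangles_at[OF v, symmetric] by blast+
  then show "D = D'"
    unfolding tri_translates[OF v] unfolding tri_def
    by (rule windmill_unique[OF translates_distinct[OF v], of D D' w]) (use *(3,4) in auto)
next
  fix v assume "v \<in> verts \<Gamma>"
  then have v: "v \<in> carrier H"
    by (simp add: verts_cayley)
  show "card {D \<in> triangles \<Gamma>. v \<in> D} = 3"
    unfolding triangles_at[OF v] using tri_distinct[OF v] by simp
qed

end

locale triangle_2_group = triangle_group H a b c S + elementary_central_series H N k
  for H (structure) and a b c S N k
begin

text \<open>Pulling \<open>g\<close> back along \<open>tri\<close> turns the sum at \<open>v\<close>
  into the kernel equation for \<open>\<one>\<close>, \<open>inv a\<close>, \<open>c\<close>; the
  three triangles being distinct, no summand is lost.\<close>

lemma incidence_injective: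
  fixes g :: "'a set \<Rightarrow> 'c::field_char_0"
  assumes g: "\<And>v. v \<in> verts \<Gamma> \<Longrightarrow> (\<Sum>D | D \<in> triangles \<Gamma> \<and> v \<in> D. g D) = 0"
  shows "\<forall>D\<in>triangles \<Gamma>. g D = 0"
proof
  fix D assume "D \<in> triangles \<Gamma>"
  then obtain h where h: "h \<in> carrier H" "D = tri h"
    using triangle_is_tri by blast
  have "g (tri v) + g (tri (v \<otimes> inv a)) + g (tri (v \<otimes> c)) = 0" if v: "v \<in> carrier H" for v
    using g[of v] v tri_distinct[OF v] unfolding triangles_at[OF v]
    by (simp add: verts_cayley add.assoc)
  from ker_trivial[OF _ _ this h(1)] show "g D = 0"
    using closed h(2) by simp
qed

end

section \<open>Presented groups\<close>

lemma rtrancl_sym_closure: "((r \<union> r\<inverse>)\<^sup>*)\<inverse> = (r \<union> r\<inverse>)\<^sup>*"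
  by (metis converse_Un converse_converse rtrancl_converse sup_commute)

locale presentation =
  fixes X :: "'a set" and R :: "'a gword set"
  assumes relators: "R \<subseteq> gwords X"
begin

abbreviation cls :: "'a gword \<Rightarrow> 'a gword set" where
  "cls w \<equiv> word_rel X R `` {w}"

lemma gwords_append [simp]: "u @ v \<in> gwords X \<longleftrightarrow> u \<in> gwords X \<and> v \<in> gwords X"
  by (auto simp: gwords_def)

lemma gwords_Nil [simp]: "[] \<in> gwords X"
  by (simp add: gwords_def)

lemma gwords_Cons [simp]: "l # w \<in> gwords X \<longleftrightarrow> fst l \<in> X \<and> w \<in> gwords X"
  by (cases l) (auto simp: gwords_def)

lemma word_rel_refl [simp]: "(w, w) \<in> word_rel X R"
  by (simp add: word_rel_def)

lemma word_rel_sym: "(v, w) \<in> word_rel X R \<Longrightarrow> (w, v) \<in> word_rel X R"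
  unfolding word_rel_def by (metis converseI rtrancl_sym_closure)

lemma word_rel_trans:
  "\<lbrakk>(u, v) \<in> word_rel X R; (v, w) \<in> word_rel X R\<rbrakk> \<Longrightarrow> (u, w) \<in> word_rel X R"
  unfolding word_rel_def by (rule rtrancl_trans)

lemma word_step_gwords: "(v, w) \<in> word_step X R \<Longrightarrow> v \<in> gwords X \<and> w \<in> gwords X"
  using relators by (auto simp: word_step_def)

lemma word_stepI:
  "\<lbrakk>u \<in> gwords X; v \<in> gwords X; r \<in> R \<union> {[(a, e), (a, \<not> e)] | a e. a \<in> X}\<rbrakk>
    \<Longrightarrow> (u @ r @ v, u @ v) \<in> word_step X R"
  unfolding word_step_def by blast

text \<open>Applied to membership in \<open>gwords\<close>, to the class of a word in a fixed
  context, and to the matrix of a word.\<close>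

lemma word_rel_invariant:
  assumes step: "\<And>v w. (v, w) \<in> word_step X R \<Longrightarrow> f v = f w" and "(v, w) \<in> word_rel X R"
  shows "f v = f w"
  using assms(2) unfolding word_rel_def
  by (induction rule: rtrancl_induct) (auto dest: step)

lemma word_rel_gwords: "(v, w) \<in> word_rel X R \<Longrightarrow> v \<in> gwords X \<longleftrightarrow> w \<in> gwords X"
  by (rule word_rel_invariant[of "\<lambda>v. v \<in> gwords X"]) (auto dest: word_step_gwords)

lemma word_rel_stepI: "(v, w) \<in> word_step X R \<Longrightarrow> (v, w) \<in> word_rel X R"
  by (auto simp: word_rel_def)

lemma cls_eq_iff: "cls v = cls w \<longleftrightarrow> (v, w) \<in> word_rel X R"
  using word_rel_sym word_rel_trans word_rel_refl by blast

lemma word_step_context: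
  assumes "(v, w) \<in> word_step X R" "u \<in> gwords X" "u' \<in> gwords X"
  shows "(u @ v @ u', u @ w @ u') \<in> word_step X R"
proof -
  from assms(1) obtain p r q where *: "v = p @ r @ q" "w = p @ q" "p \<in> gwords X" "q \<in> gwords X"
      "r \<in> R \<union> {[(a, e), (a, \<not> e)] | a e. a \<in> X}"
    unfolding word_step_def by blast
  have "u @ v @ u' = (u @ p) @ r @ (q @ u')" "u @ w @ u' = (u @ p) @ (q @ u')"
    using * by simp_all
  moreover have "((u @ p) @ r @ (q @ u'), (u @ p) @ (q @ u')) \<in> word_step X R"
    using * assms by (intro word_stepI) simp_all
  ultimately show ?thesis
    by simp
qed

lemma word_rel_context:
  assumes "(v, w) \<in> word_rel X R" "u \<in> gwords X" "u' \<in> gwords X"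
  shows "(u @ v @ u', u @ w @ u') \<in> word_rel X R"
proof -
  have "cls (u @ v @ u') = cls (u @ w @ u')"
    by (rule word_rel_invariant[of "\<lambda>v. cls (u @ v @ u')", OF _ assms(1)])
      (auto simp: cls_eq_iff intro: word_rel_stepI word_step_context assms)
  then show ?thesis
    by (simp only: cls_eq_iff)
qed

lemma word_rel_append:
  assumes "(v, v') \<in> word_rel X R" "(w, w') \<in> word_rel X R" "v \<in> gwords X" "w \<in> gwords X"
  shows "(v @ w, v' @ w') \<in> word_rel X R"
proof -
  have "v' \<in> gwords X"
    using assms word_rel_gwords by blast
  then show ?thesis
    using word_rel_context[OF assms(1), of "[]" w] word_rel_context[OF assms(2), of v' "[]"] assms
    by (auto intro: word_rel_trans)
qed

lemma carrier_presented_group: "carrier (presented_group X R) = cls ` gwords X"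
  by (auto simp: presented_group_def quotient_def)

lemma one_presented_group: "\<one>\<^bsub>presented_group X R\<^esub> = cls []"
  by (simp add: presented_group_def)

lemma mult_presented_group:
  assumes "v \<in> gwords X" "w \<in> gwords X"
  shows "cls v \<otimes>\<^bsub>presented_group X R\<^esub> cls w = cls (v @ w)"
proof -
  \<comment> \<open>The product does not depend on the representatives, so the double union is
    constant over nonempty sets.\<close>
  have "cls (v' @ w') = cls (v @ w)" if "v' \<in> cls v" "w' \<in> cls w" for v' w'
    using that assms word_rel_append[of v v' w w'] by (simp add: cls_eq_iff word_rel_sym)
  then have "(\<Union>a\<in>cls v. \<Union>b\<in>cls w. cls (a @ b)) = (\<Union>a\<in>cls v. \<Union>b\<in>cls w. cls (v @ w))"
    by (intro SUP_cong refl)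
  also have "\<dots> = cls (v @ w)"
  proof -
    have "cls v \<noteq> {}" "cls w \<noteq> {}"
      using word_rel_refl by blast+
    then show ?thesis
      by (simp only: UN_constant if_False)
  qed
  finally show ?thesis
    by (simp add: presented_group_def)
qed

definition winv :: "'a gword \<Rightarrow> 'a gword" where
  "winv w = rev (map (\<lambda>(a, e). (a, \<not> e)) w)"

lemma winv_gwords: "w \<in> gwords X \<Longrightarrow> winv w \<in> gwords X"
  by (auto simp: winv_def gwords_def)

lemma winv_left: "w \<in> gwords X \<Longrightarrow> (winv w @ w, []) \<in> word_rel X R"
proof (induction w)
  case (Cons l w)
  obtain a e where l: "l = (a, e)"
    by (cases l)
  \<comment> \<open>The double negation makes the pair an instance of the cancelling pattern in
    \<open>word_step\<close>.\<close>
  have "[(a, \<not> e), (a, \<not> \<not> e)] \<in> {[(a, e), (a, \<not> e)] | a e. a \<in> X}"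
    using Cons.prems l by simp
  then have "(winv w @ [(a, \<not> e), (a, \<not> \<not> e)] @ w, winv w @ w) \<in> word_step X R"
    using Cons.prems winv_gwords by (intro word_stepI) auto
  then have "(winv (l # w) @ (l # w), winv w @ w) \<in> word_rel X R"
    using l by (auto simp: winv_def intro: word_rel_stepI)
  with Cons show ?case
    by (auto intro: word_rel_trans)
qed (simp add: winv_def)

lemma group_presented_group: "group (presented_group X R)"
proof (rule groupI)
  fix x assume "x \<in> carrier (presented_group X R)"
  then obtain w where w: "w \<in> gwords X" "x = cls w"
    by (auto simp: carrier_presented_group)
  have "cls (winv w) \<otimes>\<^bsub>presented_group X R\<^esub> x = \<one>\<^bsub>presented_group X R\<^esub>"
    using w winv_gwords[OF w(1)] winv_left[OF w(1)]
    by (simp add: mult_presented_group one_presented_group cls_eq_iff)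
  then show "\<exists>y\<in>carrier (presented_group X R).
      y \<otimes>\<^bsub>presented_group X R\<^esub> x = \<one>\<^bsub>presented_group X R\<^esub>"
    using winv_gwords[OF w(1)] by (auto simp: carrier_presented_group)
qed (auto simp: carrier_presented_group one_presented_group mult_presented_group)

end

section \<open>The unitriangular group and the generators\<close>

lemma blk_mult_zero [simp]: "(A :: blk) ** 0 = 0" "0 ** (A :: blk) = 0"
  by (simp_all add: matrix_matrix_mult_def vec_eq_iff)

lemma blk_add_rdistrib: "((A :: blk) + B) ** C = A ** C + B ** C"
  by (simp add: matrix_matrix_mult_def vec_eq_iff distrib_right sum.distrib
    del: add_bit_eq_xor mult_bit_eq_and)

lemma blk_sum_rdistrib: "(\<Sum>i\<in>I. f i :: blk) ** (C :: blk) = (\<Sum>i\<in>I. f i ** C)"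
  by (induction I rule: infinite_finite_induct) (simp_all add: blk_add_rdistrib)

lemma blk_sum_ldistrib: "(C :: blk) ** (\<Sum>i\<in>I. f i) = (\<Sum>i\<in>I. C ** f i)"
  by (induction I rule: infinite_finite_induct) (simp_all add: matrix_add_ldistrib)

lemma blk_add_self [simp]: "(A :: blk) + A = 0"
  by (simp add: vec_eq_iff)

lemma blk_add_self_left [simp]: "(A :: blk) + (A + B) = B"
  by (simp add: add.assoc[symmetric])

lemma blk_add_eq_0_iff: "(A :: blk) + B = 0 \<longleftrightarrow> A = B"
  by (metis add_0_right blk_add_self blk_add_self_left)

section \<open>The group of unitriangular periodic matrices\<close>

lemma UT_mult: "(A \<otimes>\<^bsub>UT\<^esub> B) i j = (\<Sum>l\<in>{i..j}. A i l ** B l j)"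
  by (simp add: UT_def)

lemma UT_one: "\<one>\<^bsub>UT\<^esub> i j = (if i = j then mat 1 else 0)"
  by (simp add: UT_def)

lemma UT_carrier: "A \<in> carrier UT \<longleftrightarrow> (\<forall>i j. j < i \<longrightarrow> A i j = 0) \<and> (\<forall>i. A i i = mat 1) \<and>
    (\<forall>i j. A (i + 3) (j + 3) = A i j)"
  by (simp add: UT_def)

lemma UT_carrierD:
  assumes "A \<in> carrier UT"
  shows "j < i \<Longrightarrow> A i j = 0" "A i i = mat 1" "A (i + 3) (j + 3) = A i j"
  using assms by (simp_all add: UT_carrier)

text \<open>Both bracketings sum over the chains \<open>i \<le> p \<le> l \<le> j\<close>.\<close>

lemma UT_assoc: "(A \<otimes>\<^bsub>UT\<^esub> B) \<otimes>\<^bsub>UT\<^esub> C = A \<otimes>\<^bsub>UT\<^esub> (B \<otimes>\<^bsub>UT\<^esub> C)"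
proof (intro ext)
  fix i j
  have "((A \<otimes>\<^bsub>UT\<^esub> B) \<otimes>\<^bsub>UT\<^esub> C) i j = (\<Sum>l\<in>{i..j}. \<Sum>p | p \<in> {i..j} \<and> p \<le> l. A i p ** B p l ** C l j)"
    unfolding UT_mult blk_sum_rdistrib by (intro sum.cong) auto
  also have "\<dots> = (\<Sum>p\<in>{i..j}. \<Sum>l | l \<in> {i..j} \<and> p \<le> l. A i p ** B p l ** C l j)"
    by (rule sum.swap_restrict) auto
  also have "\<dots> = (A \<otimes>\<^bsub>UT\<^esub> (B \<otimes>\<^bsub>UT\<^esub> C)) i j"
    unfolding UT_mult blk_sum_ldistrib matrix_mul_assoc by (intro sum.cong) auto
  finally show "((A \<otimes>\<^bsub>UT\<^esub> B) \<otimes>\<^bsub>UT\<^esub> C) i j = (A \<otimes>\<^bsub>UT\<^esub> (B \<otimes>\<^bsub>UT\<^esub> C)) i j" .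
qed

lemma UT_mult_closed:
  assumes "A \<in> carrier UT" "B \<in> carrier UT"
  shows "A \<otimes>\<^bsub>UT\<^esub> B \<in> carrier UT"
  unfolding UT_carrier UT_mult
  using UT_carrierD[OF assms(1)] UT_carrierD[OF assms(2)]
  by (simp add: sum.shift_bounds_cl_nat_ivl del: sum.cl_ivl_Suc)

lemma UT_one_left:
  assumes "A \<in> carrier UT"
  shows "\<one>\<^bsub>UT\<^esub> \<otimes>\<^bsub>UT\<^esub> A = A"
proof (intro ext)
  fix i j
  have "(\<one>\<^bsub>UT\<^esub> \<otimes>\<^bsub>UT\<^esub> A) i j = (\<Sum>l\<in>{i..j}. if i = l then A l j else 0)"
    unfolding UT_mult UT_one by (intro sum.cong) auto
  then show "(\<one>\<^bsub>UT\<^esub> \<otimes>\<^bsub>UT\<^esub> A) i j = A i j"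
    using UT_carrierD[OF assms] by simp
qed

text \<open>Solves \<open>L A = 1\<close> column by column, using \<open>A j j = 1\<close>; no signs
  appear in characteristic 2.\<close>

function left_inverse :: "blkmat \<Rightarrow> nat \<Rightarrow> nat \<Rightarrow> blk" where
  "left_inverse A i j = (if j < i then 0 else if j = i then mat 1
     else (\<Sum>l\<in>{i..<j}. left_inverse A i l ** A l j))"
  by pat_completeness auto
termination
  by (relation "Wellfounded.measure (\<lambda>(A, i, j). j)") auto

declare left_inverse.simps [simp del]

lemma left_inverse_periodic:
  assumes "A \<in> carrier UT"
  shows "left_inverse A (i + 3) (j + 3) = left_inverse A i j"
proof (induction j rule: less_induct)
  case (less j)
  have "(\<Sum>l\<in>{i + 3..<j + 3}. left_inverse A (i + 3) l ** A l (j + 3)) =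
      (\<Sum>l\<in>{i..<j}. left_inverse A i l ** A l j)"
    unfolding sum.shift_bounds_nat_ivl
    by (intro sum.cong refl) (simp add: less UT_carrierD(3)[OF assms])
  then show ?case
    unfolding left_inverse.simps[of A "i + 3" "j + 3"] left_inverse.simps[of A i j] by simp
qed

lemma left_inverse_closed:
  assumes "A \<in> carrier UT"
  shows "left_inverse A \<in> carrier UT"
  unfolding UT_carrier using left_inverse_periodic[OF assms]
  by (simp add: left_inverse.simps)

lemma left_inverse_mult:
  assumes "A \<in> carrier UT"
  shows "left_inverse A \<otimes>\<^bsub>UT\<^esub> A = \<one>\<^bsub>UT\<^esub>"
proof (intro ext)
  fix i j :: nat
  consider "j < i" | "j = i" | "i < j"
    by linarith
  then show "(left_inverse A \<otimes>\<^bsub>UT\<^esub> A) i j = \<one>\<^bsub>UT\<^esub> i j"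
  proof cases
    case 3
    then have "{i..j} = insert j {i..<j}"
      by auto
    then show ?thesis
      using 3 UT_carrierD(2)[OF assms]
      by (simp add: UT_mult UT_one left_inverse.simps[of A i j])
  qed (simp_all add: UT_mult UT_one UT_carrierD(2)[OF assms] left_inverse.simps)
qed

lemma group_UT: "group UT"
proof (rule groupI)
  show "\<one>\<^bsub>UT\<^esub> \<in> carrier UT"
    by (simp add: UT_carrier UT_one)
qed (auto simp: UT_mult_closed UT_assoc UT_one_left intro: left_inverse_closed left_inverse_mult)

interpretation UT: group UT
  by (rule group_UT)

section \<open>Congruence modulo the diagonals beyond the k-th\<close>

definition trunc_eq :: "nat \<Rightarrow> blkmat \<Rightarrow> blkmat \<Rightarrow> bool" where
  "trunc_eq k A B \<longleftrightarrow> (\<forall>m. \<forall>d\<le>k. A m (m + d) = B m (m + d))"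

lemma trunc_eq_refl [simp]: "trunc_eq k A A"
  by (simp add: trunc_eq_def)

lemma trunc_eq_sym: "trunc_eq k A B \<Longrightarrow> trunc_eq k B A"
  by (simp add: trunc_eq_def)

lemma trunc_eq_mono: "\<lbrakk>trunc_eq k A B; j \<le> k\<rbrakk> \<Longrightarrow> trunc_eq j A B"
  by (simp add: trunc_eq_def)

text \<open>The d-th diagonal of a product involves only the diagonals up to \<open>d\<close> of its
  factors.\<close>

lemma trunc_eq_mult:
  assumes "trunc_eq k A A'" "trunc_eq k B B'"
  shows "trunc_eq k (A \<otimes>\<^bsub>UT\<^esub> B) (A' \<otimes>\<^bsub>UT\<^esub> B')"
  unfolding trunc_eq_def UT_mult
proof (intro allI impI sum.cong refl)
  fix m d l assume "d \<le> k" and l: "l \<in> {m..m + d}"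
  then have "A m (m + (l - m)) = A' m (m + (l - m))"
      "B l (l + (m + d - l)) = B' l (l + (m + d - l))"
    using assms[unfolded trunc_eq_def, rule_format, of "l - m" m]
      assms[unfolded trunc_eq_def, rule_format, of "m + d - l" l] l by auto
  with l show "A m l ** B l (m + d) = A' m l ** B' l (m + d)"
    by simp
qed

lemma UT_mult_entry:
  assumes "A \<in> carrier UT" "B \<in> carrier UT" "m < n"
  shows "(A \<otimes>\<^bsub>UT\<^esub> B) m n = A m n + B m n + (\<Sum>l\<in>{m<..<n}. A m l ** B l n)"
proof -
  have "{m..n} = insert m (insert n {m<..<n})"
    using assms(3) by auto
  then show ?thesis
    using assms(3) UT_carrierD(2)[OF assms(1)] UT_carrierD(2)[OF assms(2)]
    by (simp add: UT_mult algebra_simps)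
qed

lemma trunc_eq_one_entry: "\<lbrakk>trunc_eq j A \<one>\<^bsub>UT\<^esub>; m < n; n \<le> m + j\<rbrakk> \<Longrightarrow> A m n = 0"
  unfolding trunc_eq_def by (elim allE[of _ m] allE[of _ "n - m"]) (simp add: UT_one)

text \<open>In the inner sum of the product formula every block of \<open>A\<close> lies on one of
  the diagonals 1 to \<open>j\<close> and vanishes.\<close>

lemma trunc_eq_one_mult_entry:
  assumes "A \<in> carrier UT" "B \<in> carrier UT" "trunc_eq j A \<one>\<^bsub>UT\<^esub>" "m < n" "n \<le> m + Suc j"
  shows "(A \<otimes>\<^bsub>UT\<^esub> B) m n = A m n + B m n" "(B \<otimes>\<^bsub>UT\<^esub> A) m n = A m n + B m n"
  using assms(4,5) trunc_eq_one_entry[OF assms(3)]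
  by (simp_all add: UT_mult_entry assms(1,2) add.commute)

lemma trunc_eq_one_commute:
  assumes "A \<in> carrier UT" "B \<in> carrier UT" "trunc_eq j A \<one>\<^bsub>UT\<^esub>"
  shows "trunc_eq (Suc j) (A \<otimes>\<^bsub>UT\<^esub> B) (B \<otimes>\<^bsub>UT\<^esub> A)"
  unfolding trunc_eq_def
proof (intro allI impI)
  fix m d assume "d \<le> Suc j"
  then show "(A \<otimes>\<^bsub>UT\<^esub> B) m (m + d) = (B \<otimes>\<^bsub>UT\<^esub> A) m (m + d)"
    using trunc_eq_one_mult_entry[OF assms, of m "m + d"] UT_mult_closed assms(1,2)
    by (cases "d = 0") (simp_all add: UT_carrierD)
qed

text \<open>The diagonal \<open>Suc j\<close> is doubled, hence 0. With
  \<open>trunc_eq_one_commute\<close> this makes the filtration an elementary central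
  series.\<close>

lemma trunc_eq_one_square:
  assumes "A \<in> carrier UT" "trunc_eq j A \<one>\<^bsub>UT\<^esub>"
  shows "trunc_eq (Suc j) (A \<otimes>\<^bsub>UT\<^esub> A) \<one>\<^bsub>UT\<^esub>"
  unfolding trunc_eq_def
proof (intro allI impI)
  fix m d assume "d \<le> Suc j"
  then show "(A \<otimes>\<^bsub>UT\<^esub> A) m (m + d) = \<one>\<^bsub>UT\<^esub> m (m + d)"
    using trunc_eq_one_mult_entry[OF assms(1) assms, of m "m + d"] UT_mult_closed assms(1)
    by (cases "d = 0") (simp_all add: UT_carrierD UT_one)
qed

section \<open>Powers of the Frobenius and of zeta\<close>

lemma blk_pow_0 [simp]: "blk_pow A 0 = mat 1"
  by (simp add: blk_pow_def)

lemma blk_pow_Suc: "blk_pow A (Suc n) = blk_pow A n ** A"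
  by (simp add: blk_pow_def)

lemma blk_pow_add: "blk_pow A (m + n) = blk_pow A m ** blk_pow A n"
  by (induction n) (simp_all add: blk_pow_Suc matrix_mul_assoc)

lemma blk_pow_periodic:
  assumes "blk_pow A p = mat 1"
  shows "blk_pow A (n mod p) = blk_pow A n"
proof -
  have "blk_pow A (p * q) = mat 1" for q
    by (induction q) (simp_all add: blk_pow_add assms)
  then have "blk_pow A (p * (n div p) + n mod p) = blk_pow A (n mod p)"
    by (simp only: blk_pow_add matrix_mul_lid)
  then show ?thesis
    by simp
qed

lemma frob_3: "blk_pow frob 3 = mat 1"
  by (simp add: blk_pow_Suc numeral_eq_Suc)
    (simp add: frob_def vec_eq_iff forall_3 matrix_matrix_mult_def sum_3 mat_def)

abbreviation zp :: "nat \<Rightarrow> blk" where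
  "zp n \<equiv> blk_pow mul_zeta n"

lemma zp_7: "zp 7 = mat 1"
  by (simp add: blk_pow_Suc numeral_eq_Suc)
    (simp add: mul_zeta_def vec_eq_iff forall_3 matrix_matrix_mult_def sum_3 mat_def)

lemma zp_cong: "m mod 7 = n mod 7 \<Longrightarrow> zp m = zp n"
  by (metis blk_pow_periodic zp_7)

text \<open>The defining relation of \<open>\<zeta>\<close> and its Frobenius conjugates.\<close>

lemma zp_sum: "mat 1 + zp 1 + zp 3 = 0" "mat 1 + zp 2 + zp 6 = 0" "mat 1 + zp 4 + zp 12 = 0"
  by (simp_all add: blk_pow_Suc numeral_eq_Suc)
    (simp_all add: mul_zeta_def vec_eq_iff forall_3 matrix_matrix_mult_def sum_3 mat_def)

text \<open>As matrices act on row vectors, this is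
  \<open>\<phi>(a \<zeta>^n) = \<phi>(a) \<zeta>^(2 n)\<close>.\<close>

lemma zp_frob: "zp n ** frob = frob ** zp (2 * n)"
proof (induction n)
  case (Suc n)
  have base: "mul_zeta ** frob = frob ** (mul_zeta ** mul_zeta)"
    by (simp add: mul_zeta_def frob_def vec_eq_iff forall_3 matrix_matrix_mult_def sum_3 mat_def)
  have "zp (Suc n) ** frob = zp n ** frob ** (mul_zeta ** mul_zeta)"
    by (simp add: blk_pow_Suc base matrix_mul_assoc[symmetric])
  then show ?case
    by (simp add: Suc blk_pow_Suc matrix_mul_assoc)
qed simp

lemma zp_frob_pow: "zp n ** blk_pow frob d = blk_pow frob d ** zp (2 ^ d * n)"
proof (induction d arbitrary: n)
  case (Suc d)
  have "zp n ** blk_pow frob (Suc d) = blk_pow frob d ** (zp (2 ^ d * n) ** frob)"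
    by (simp add: blk_pow_Suc matrix_mul_assoc Suc)
  then show ?case
    by (simp add: zp_frob blk_pow_Suc matrix_mul_assoc mult.assoc)
qed simp

section \<open>Bidiagonal matrices and one-sided multiplications\<close>

definition band :: "(nat \<Rightarrow> blk) \<Rightarrow> blkmat" where
  "band u = (\<lambda>m n. if n = m then mat 1 else if n = Suc m then u m else 0)"

lemma band_closed: "(\<And>m. u (m + 3) = u m) \<Longrightarrow> band u \<in> carrier UT"
  by (auto simp: UT_carrier band_def)

lemma band_mult:
  assumes "\<And>i j. j < i \<Longrightarrow> B i j = 0"
  shows "(band u \<otimes>\<^bsub>UT\<^esub> B) m n = (if n < m then 0 else B m n + u m ** B (Suc m) n)"
proof (cases "m < n")
  case True
  then have "{m..n} = insert m (insert (Suc m) {Suc (Suc m)..n})"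
    by auto
  moreover have "(\<Sum>l\<in>{Suc (Suc m)..n}. band u m l ** B l n) = 0"
    by (rule sum.neutral) (auto simp: band_def)
  ultimately show ?thesis
    using True by (simp add: UT_mult band_def)
next
  case False
  then show ?thesis
    using assms by (auto simp: UT_mult band_def not_less le_less)
qed

lemma band_band:
  "(band u \<otimes>\<^bsub>UT\<^esub> band v) m n = (if n = m then mat 1 else if n = Suc m then u m + v m
    else if n = Suc (Suc m) then u m ** v (Suc m) else 0)"
proof -
  have eq: "(band u \<otimes>\<^bsub>UT\<^esub> band v) m n = (if n < m then 0 else band v m n + u m ** band v (Suc m) n)"
    by (rule band_mult) (simp add: band_def)
  show ?thesis
    unfolding eq by (auto simp: band_def add.commute)
qed

lemma band_commute:
  assumes "\<And>m. u m ** v (Suc m) = v m ** u (Suc m)"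
  shows "band u \<otimes>\<^bsub>UT\<^esub> band v = band v \<otimes>\<^bsub>UT\<^esub> band u"
  by (intro ext) (simp add: band_band assms add.commute)

text \<open>The conditions compare coefficients with \<open>1 + \<tau>^3\<close>: zero on the first
  and second diagonals, the identity on the third.\<close>

lemma band_mult3:
  assumes "\<And>m. u m + v m + w m = 0"
    and "\<And>m. u m ** v (Suc m) + u m ** w (Suc m) + v m ** w (Suc m) = 0"
    and "\<And>m. u m ** v (Suc m) ** w (Suc (Suc m)) = mat 1"
  shows "band u \<otimes>\<^bsub>UT\<^esub> (band v \<otimes>\<^bsub>UT\<^esub> band w) = (\<lambda>m n. if n = m \<or> n = m + 3 then mat 1 else 0)"
proof (intro ext)
  fix m n
  have "(band u \<otimes>\<^bsub>UT\<^esub> (band v \<otimes>\<^bsub>UT\<^esub> band w)) m n = (if n < m then 0 else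
      (band v \<otimes>\<^bsub>UT\<^esub> band w) m n + u m ** (band v \<otimes>\<^bsub>UT\<^esub> band w) (Suc m) n)" (is "?lhs = ?rhs")
    by (rule band_mult) (simp add: band_band)
  also have "?rhs = (if n = m \<or> n = m + 3 then mat 1 else 0)"
  proof -
    have "v m + w m + u m = 0"
      using assms(1)[of m] by (simp add: ac_simps)
    moreover have "v m ** w (Suc m) + u m ** (v (Suc m) + w (Suc m)) = 0"
      using assms(2)[of m] by (simp add: ac_simps matrix_add_ldistrib)
    moreover have "u m ** (v (Suc m) ** w (Suc (Suc m))) = mat 1"
      using assms(3)[of m] by (simp add: matrix_mul_assoc)
    moreover consider "n < m" | "n = m" | "n = Suc m" | "n = m + 2" | "n = m + 3" | "n > m + 3"
      by linarith
    ultimately show ?thesis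
      by cases (simp_all add: band_band)
  qed
  finally show "?lhs = (if n = m \<or> n = m + 3 then mat 1 else 0)" .
qed

text \<open>Left multiplication by \<open>b_i\<close>, which sends \<open>a \<tau>^m\<close> to
  \<open>a \<tau>^m + \<phi>(a) \<zeta>^i \<tau>^(m+1)\<close>.\<close>

abbreviation lmul :: "nat \<Rightarrow> blkmat" where
  "lmul i \<equiv> band (\<lambda>m. frob ** zp i)"

text \<open>Right multiplication by \<open>b_i\<close>: moving \<open>\<tau>^m\<close> past
  \<open>\<zeta>^i\<close> raises the latter to the power \<open>2^m\<close>.\<close>

abbreviation rmul :: "nat \<Rightarrow> blkmat" where
  "rmul i \<equiv> band (\<lambda>m. zp (i * 2 ^ m))"

lemma lmul_closed: "lmul i \<in> carrier UT"
  by (rule band_closed) simp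

text \<open>\<open>2^3\<close> is 1 modulo 7. The summand \<open>l\<close> fits the exponents in
  \<open>gen_mat\<close>.\<close>

lemma zp_mult_8: "zp (k + i * (2 ^ (m + 3) + l)) = zp (k + i * (2 ^ m + l))"
proof (rule zp_cong)
  have "k + i * (2 ^ (m + 3) + l) = k + i * (2 ^ m + l) + 7 * (i * 2 ^ m)"
    by (simp add: power_add algebra_simps)
  then show "(k + i * (2 ^ (m + 3) + l)) mod 7 = (k + i * (2 ^ m + l)) mod 7"
    by (simp only: mod_mult_self2)
qed

lemma rmul_closed: "rmul i \<in> carrier UT"
  using zp_mult_8[of 0 i _ 0] by (intro band_closed) simp

lemma gen_mat_closed: "gen_mat i \<in> carrier UT"
  unfolding UT_carrier
proof (intro conjI allI impI)
  fix m n
  show "gen_mat i (m + 3) (n + 3) = gen_mat i m n"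
  proof (cases "m < n")
    case True
    then obtain p where p: "n = Suc p"
      by (cases n) auto
    have "zp (i * (2 ^ (n - m - 1) - 1 + 2 ^ (n + 3 - 1))) = zp (i * (2 ^ (n - m - 1) - 1 + 2 ^ (n - 1)))"
      using zp_mult_8[of 0 i p "2 ^ (n - m - 1) - 1"] by (simp add: p add.commute)
    then show ?thesis
      using True by (simp add: gen_mat_def)
  qed (simp add: gen_mat_def)
qed (simp_all add: gen_mat_def)

text \<open>Left multiplication by \<open>b\<^sub>i\<close> followed by \<open>y \<mapsto> b\<^sub>i\<inverse> y b\<^sub>i\<close> is right multiplication by \<open>b\<^sub>i\<close>.\<close>

lemma lmul_gen_mat: "lmul i \<otimes>\<^bsub>UT\<^esub> gen_mat i = rmul i"
proof (intro ext)
  fix m n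
  have eq: "(lmul i \<otimes>\<^bsub>UT\<^esub> gen_mat i) m n =
      (if n < m then 0 else gen_mat i m n + frob ** zp i ** gen_mat i (Suc m) n)"
    by (rule band_mult) (simp add: gen_mat_def)
  have frob: "frob ** blk_pow frob d = blk_pow frob (Suc d)" "blk_pow frob (Suc 0) = frob" for d
    using blk_pow_add[of frob 1 d] by (simp_all add: blk_pow_Suc)
  have "n < m \<or> n = m \<or> n = Suc m \<or> n = Suc (Suc (m + (n - m - 2)))"
    by linarith
  then consider "n < m" | "n = m" | "n = Suc m" | d where "n = Suc (Suc (m + d))"
    by blast
  then show "(lmul i \<otimes>\<^bsub>UT\<^esub> gen_mat i) m n = rmul i m n"
  proof cases
    case 1
    then show ?thesis
      unfolding eq by (simp add: band_def)
  next
    case 2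
    then show ?thesis
      unfolding eq by (simp add: gen_mat_def band_def)
  next
    case 3
    then show ?thesis
      unfolding eq by (simp add: gen_mat_def band_def frob add.commute add.left_commute)
  next
    case (4 d)
    have key: "frob ** zp i ** (blk_pow frob e ** zp x) = blk_pow frob (Suc e) ** zp (2 ^ e * i + x)"
      for e x
    proof -
      have "frob ** zp i ** (blk_pow frob e ** zp x) = frob ** (zp i ** blk_pow frob e) ** zp x"
        by (simp only: matrix_mul_assoc)
      then show ?thesis
        unfolding zp_frob_pow by (simp only: matrix_mul_assoc frob blk_pow_add)
    qed
    have e: "2 ^ e * i + i * (2 ^ e - 1 + x) = i * (2 ^ Suc e - 1 + x)" for e x
    proof -
      obtain q where "(2::nat) ^ e = Suc q"
        by (metis not0_implies_Suc power_not_zero zero_neq_numeral)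
      then show ?thesis
        by (simp add: algebra_simps)
    qed
    \<comment> \<open>The summand 0 gives both terms the exponent shape treated in
      \<open>e\<close>.\<close>
    have g: "gen_mat i m n = blk_pow frob (Suc (Suc d)) ** zp (i * (2 ^ Suc (Suc d) - 1 + 0)) +
        blk_pow frob (Suc d) ** zp (i * (2 ^ Suc d - 1 + 2 ^ (n - 1)))"
      "gen_mat i (Suc m) n = blk_pow frob (Suc d) ** zp (i * (2 ^ Suc d - 1 + 0)) +
        blk_pow frob d ** zp (i * (2 ^ d - 1 + 2 ^ (n - 1)))"
      by (simp_all add: gen_mat_def 4 Suc_diff_le del: power_Suc)
    \<comment> \<open>Beyond the first diagonal the two contributions agree and cancel in
      characteristic 2.\<close>
    have "frob ** zp i ** gen_mat i (Suc m) n = gen_mat i m n"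
      unfolding g matrix_add_ldistrib key e ..
    then show ?thesis
      unfolding eq using 4 by (simp add: band_def)
  qed
qed

text \<open>Left and right multiplications commute; on the second diagonal both orders give
  \<open>frob\<close> times the same power of zeta.\<close>

lemma lmul_rmul_commute: "lmul i \<otimes>\<^bsub>UT\<^esub> rmul j = rmul j \<otimes>\<^bsub>UT\<^esub> lmul i"
proof (rule band_commute)
  fix m
  have "zp (j * 2 ^ m) ** frob ** zp i = frob ** zp (2 * (j * 2 ^ m) + i)"
    by (simp add: zp_frob blk_pow_add matrix_mul_assoc)
  moreover have "frob ** zp i ** zp (j * 2 ^ Suc m) = frob ** zp (i + j * 2 ^ Suc m)"
    by (simp add: blk_pow_add matrix_mul_assoc)
  ultimately show "frob ** zp i ** zp (j * 2 ^ Suc m) = zp (j * 2 ^ m) ** (frob ** zp i)"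
    by (simp add: matrix_mul_assoc ac_simps)
qed

lemma zp_sum_pow2: "mat 1 + zp (2 ^ m) + zp (3 * 2 ^ m) = 0"
proof -
  have "(2::nat) ^ m mod 7 \<in> {1, 2, 4}"
  proof (induction m)
    case (Suc m)
    have "(2::nat) ^ Suc m mod 7 = 2 * (2 ^ m mod 7) mod 7"
      by (simp add: mod_mult_right_eq)
    with Suc show ?case
      by auto
  qed simp
  moreover have "zp (2 ^ m) = zp (2 ^ m mod 7)" "zp (3 * 2 ^ m) = zp (3 * (2 ^ m mod 7))"
    by (rule zp_cong, simp add: mod_mult_right_eq)+
  ultimately show ?thesis
    using zp_sum by (elim insertE emptyE) simp_all
qed

text \<open>The coefficients of \<open>\<tau>\<close>, \<open>\<tau>^2\<close>,
  \<open>\<tau>^3\<close> in \<open>b_i b_j b_k\<close>, twisted by \<open>\<phi>^m\<close>; each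
  \<open>\<tau>\<close> doubles the exponents to its right.\<close>

lemma zp_relator:
  fixes i j k :: nat
  assumes "j mod 7 = (i + 1) mod 7" "k mod 7 = (i + 3) mod 7"
  shows "zp (i * 2 ^ m) + zp (j * 2 ^ m) + zp (k * 2 ^ m) = 0"
    and "zp ((i + 2 * j) * 2 ^ m) + zp ((i + 2 * k) * 2 ^ m) + zp ((j + 2 * k) * 2 ^ m) = 0"
    and "zp ((i + 2 * j + 4 * k) * 2 ^ m) = mat 1"
proof -
  \<comment> \<open>Both sums reduce to a power of zeta times a conjugate of
    \<open>1 + \<zeta> + \<zeta>^3\<close>; the exponents of the second are \<open>3 i + 2\<close>,
    \<open>3 i\<close>, \<open>3 i + 6\<close> modulo 7, times \<open>2^m\<close>.\<close>
  have fac: "zp x + zp (x + 2 ^ p) + zp (x + 3 * 2 ^ p) = 0" for x p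
  proof -
    have "zp x + zp (x + 2 ^ p) + zp (x + 3 * 2 ^ p) = zp x ** (mat 1 + zp (2 ^ p) + zp (3 * 2 ^ p))"
      by (simp only: blk_pow_add matrix_add_ldistrib matrix_mul_rid)
    then show ?thesis
      by (simp add: zp_sum_pow2)
  qed
  have cong: "zp (x * 2 ^ m) = zp (y * 2 ^ m)" if "x mod 7 = y mod 7" for x y
    using that by (intro zp_cong) (metis mod_mult_left_eq)
  have "zp (j * 2 ^ m) = zp ((i + 1) * 2 ^ m)" "zp (k * 2 ^ m) = zp ((i + 3) * 2 ^ m)"
    by (rule cong, rule assms)+
  then show "zp (i * 2 ^ m) + zp (j * 2 ^ m) + zp (k * 2 ^ m) = 0"
    using fac[of "i * 2 ^ m" m] by (simp add: algebra_simps)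
  have mods: "(i + 2 * j) mod 7 = (i + 2 * (i + 1)) mod 7" "(i + 2 * k) mod 7 = (i + 2 * (i + 3)) mod 7"
      "(j + 2 * k) mod 7 = ((i + 1) + 2 * (i + 3)) mod 7"
      "(i + 2 * j + 4 * k) mod 7 = (i + 2 * (i + 1) + 4 * (i + 3)) mod 7"
    by (intro mod_add_cong mod_mult_cong refl assms)+
  have "(i + 1) + 2 * (i + 3) = 3 * i + 7 * 1" "i + 2 * (i + 1) + 4 * (i + 3) = 0 + 7 * (i + 2)"
    by simp_all
  then have mods': "(j + 2 * k) mod 7 = (3 * i) mod 7" "(i + 2 * j + 4 * k) mod 7 = 0 mod 7"
    unfolding mods by (simp_all only: mod_mult_self2)
  have "zp ((i + 2 * j) * 2 ^ m) = zp ((i + 2 * (i + 1)) * 2 ^ m)"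
       "zp ((i + 2 * k) * 2 ^ m) = zp ((i + 2 * (i + 3)) * 2 ^ m)"
       "zp ((j + 2 * k) * 2 ^ m) = zp ((3 * i) * 2 ^ m)"
       "zp ((i + 2 * j + 4 * k) * 2 ^ m) = zp (0 * 2 ^ m)"
    by (rule cong, rule mods mods')+
  then show "zp ((i + 2 * j) * 2 ^ m) + zp ((i + 2 * k) * 2 ^ m) + zp ((j + 2 * k) * 2 ^ m) = 0"
    and "zp ((i + 2 * j + 4 * k) * 2 ^ m) = mat 1"
    using fac[of "3 * i * 2 ^ m" "Suc m"] by (simp_all add: algebra_simps)
qed

text \<open>After multiplication from the left by the three \<open>lmul\<close>, each
  \<open>lmul\<close> meets its \<open>gen_mat\<close>, and the resulting \<open>rmul\<close> moves
  outwards past the remaining ones. Both triple products are multiplication by the central element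
  \<open>1 + \<tau>^3\<close>, which cancels.\<close>

lemma gen_mat_relator:
  assumes "j mod 7 = (i + 1) mod 7" "k mod 7 = (i + 3) mod 7"
  shows "gen_mat i \<otimes>\<^bsub>UT\<^esub> (gen_mat j \<otimes>\<^bsub>UT\<^esub> gen_mat k) = \<one>\<^bsub>UT\<^esub>"
proof -
  let ?P = "\<lambda>m n. if n = m \<or> n = m + 3 then mat 1 else 0 :: blk"
  note z = zp_relator[OF assms]
  have R: "rmul i \<otimes>\<^bsub>UT\<^esub> (rmul j \<otimes>\<^bsub>UT\<^esub> rmul k) = ?P"
  proof (rule band_mult3)
    fix m
    have e: "x * 2 ^ m + y * 2 ^ Suc m = (x + 2 * y) * 2 ^ m" for x y :: nat
      by (simp add: algebra_simps)
    have e3: "i * 2 ^ m + j * 2 ^ Suc m + k * 2 ^ Suc (Suc m) = (i + 2 * j + 4 * k) * 2 ^ m"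
      by (simp add: algebra_simps)
    show "zp (i * 2 ^ m) + zp (j * 2 ^ m) + zp (k * 2 ^ m) = 0"
      by (rule z)
    show "zp (i * 2 ^ m) ** zp (j * 2 ^ Suc m) + zp (i * 2 ^ m) ** zp (k * 2 ^ Suc m)
        + zp (j * 2 ^ m) ** zp (k * 2 ^ Suc m) = 0"
      unfolding blk_pow_add[symmetric] e by (rule z)
    show "zp (i * 2 ^ m) ** zp (j * 2 ^ Suc m) ** zp (k * 2 ^ Suc (Suc m)) = mat 1"
      unfolding blk_pow_add[symmetric] e3 by (rule z)
  qed
  have fz: "frob ** zp x ** (frob ** zp y) = frob ** frob ** zp (y + 2 * x)" for x y
  proof -
    have "frob ** zp x ** (frob ** zp y) = frob ** (zp x ** frob) ** zp y"
      by (simp only: matrix_mul_assoc)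
    then show ?thesis
      by (simp only: zp_frob matrix_mul_assoc blk_pow_add add.commute[of y])
  qed
  \<comment> \<open>On row vectors left multiplications compose in the opposite order, so this is
    left multiplication by \<open>b_i b_j b_k\<close>.\<close>
  have L: "lmul k \<otimes>\<^bsub>UT\<^esub> (lmul j \<otimes>\<^bsub>UT\<^esub> lmul i) = ?P"
  proof (rule band_mult3)
    have "frob ** zp k + frob ** zp j + frob ** zp i = frob ** (zp i + zp j + zp k)"
      by (simp add: matrix_add_ldistrib ac_simps)
    then show "frob ** zp k + frob ** zp j + frob ** zp i = 0"
      using z(1)[of 0] by simp
    have "frob ** zp k ** (frob ** zp j) + frob ** zp k ** (frob ** zp i) + frob ** zp j ** (frob ** zp i)
        = frob ** frob ** (zp (i + 2 * j) + zp (i + 2 * k) + zp (j + 2 * k))"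
      by (simp add: fz matrix_add_ldistrib ac_simps)
    then show "frob ** zp k ** (frob ** zp j) + frob ** zp k ** (frob ** zp i) + frob ** zp j ** (frob ** zp i) = 0"
      using z(2)[of 0] by simp
    have "frob ** zp k ** (frob ** zp j) ** (frob ** zp i) = frob ** frob ** (zp (j + 2 * k) ** frob) ** zp i"
      by (simp only: fz) (simp only: matrix_mul_assoc)
    also have "\<dots> = frob ** frob ** frob ** zp (2 * (j + 2 * k) + i)"
      by (simp only: zp_frob) (simp only: matrix_mul_assoc blk_pow_add)
    also have "2 * (j + 2 * k) + i = (i + 2 * j + 4 * k) * 2 ^ 0"
      by simp
    also have "frob ** frob ** frob = mat 1"
      using frob_3 by (simp add: blk_pow_Suc numeral_eq_Suc)
    finally show "frob ** zp k ** (frob ** zp j) ** (frob ** zp i) = mat 1"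
      by (simp only: z(3) matrix_mul_lid)
  qed
  let ?g = "gen_mat i \<otimes>\<^bsub>UT\<^esub> (gen_mat j \<otimes>\<^bsub>UT\<^esub> gen_mat k)"
  note closed = lmul_closed rmul_closed gen_mat_closed
  have "?P \<otimes>\<^bsub>UT\<^esub> ?g = lmul k \<otimes>\<^bsub>UT\<^esub> (lmul j \<otimes>\<^bsub>UT\<^esub> ((lmul i \<otimes>\<^bsub>UT\<^esub> gen_mat i) \<otimes>\<^bsub>UT\<^esub> (gen_mat j \<otimes>\<^bsub>UT\<^esub> gen_mat k)))"
    unfolding L[symmetric] by (simp only: UT_assoc)
  also have "\<dots> = lmul k \<otimes>\<^bsub>UT\<^esub> ((lmul j \<otimes>\<^bsub>UT\<^esub> rmul i) \<otimes>\<^bsub>UT\<^esub> (gen_mat j \<otimes>\<^bsub>UT\<^esub> gen_mat k))"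
    unfolding lmul_gen_mat by (simp only: UT_assoc)
  also have "\<dots> = (lmul k \<otimes>\<^bsub>UT\<^esub> rmul i) \<otimes>\<^bsub>UT\<^esub> ((lmul j \<otimes>\<^bsub>UT\<^esub> gen_mat j) \<otimes>\<^bsub>UT\<^esub> gen_mat k)"
    unfolding lmul_rmul_commute[of j i] by (simp only: UT_assoc)
  also have "\<dots> = rmul i \<otimes>\<^bsub>UT\<^esub> ((lmul k \<otimes>\<^bsub>UT\<^esub> rmul j) \<otimes>\<^bsub>UT\<^esub> gen_mat k)"
    unfolding lmul_gen_mat lmul_rmul_commute[of k i] by (simp only: UT_assoc)
  also have "\<dots> = rmul i \<otimes>\<^bsub>UT\<^esub> (rmul j \<otimes>\<^bsub>UT\<^esub> (lmul k \<otimes>\<^bsub>UT\<^esub> gen_mat k))"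
    unfolding lmul_rmul_commute[of k j] by (simp only: UT_assoc)
  also have "\<dots> = ?P"
    unfolding lmul_gen_mat by (rule R)
  finally have "?P \<otimes>\<^bsub>UT\<^esub> ?g = ?P" .
  moreover have "?P \<in> carrier UT"
    unfolding R[symmetric] by (intro UT.m_closed closed)
  ultimately show ?thesis
    using UT.r_cancel_one[of ?P ?g] closed by simp
qed

section \<open>Explicit blocks on the first two diagonals\<close>

lemma zp_2: "zp 2 = vector [vector [0, 0, 1], vector [1, 1, 0], vector [0, 1, 1]]"
  by (simp add: numeral_eq_Suc blk_pow_Suc mul_zeta_def)
    (simp add: vec_eq_iff forall_3 vector_3 matrix_matrix_mult_def sum_3)

lemma zp_3: "zp 3 = vector [vector [1, 1, 0], vector [0, 1, 1], vector [1, 1, 1]]"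
  using blk_pow_add[of mul_zeta 2 1] unfolding zp_2
  by (simp add: blk_pow_Suc mul_zeta_def)
    (simp add: vec_eq_iff forall_3 vector_3 matrix_matrix_mult_def sum_3)

lemma zp_6: "zp 6 = vector [vector [1, 0, 1], vector [1, 0, 0], vector [0, 1, 0]]"
  using blk_pow_add[of mul_zeta 3 3] unfolding zp_3
  by simp (simp add: vec_eq_iff forall_3 vector_3 matrix_matrix_mult_def sum_3)

lemma zp_9: "zp 9 = zp 2"
  by (rule zp_cong) simp

lemma frob_2: "frob ** frob = vector [vector [1, 0, 0], vector [0, 1, 1], vector [0, 1, 0]]"
  unfolding frob_def by (simp add: vec_eq_iff forall_3 vector_3 matrix_matrix_mult_def sum_3)

lemma gen_mat_blocks:
  shows "gen_mat 0 0 1 = vector [vector [0, 0, 0], vector [0, 1, 1], vector [0, 1, 0]]"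
    "gen_mat 1 0 1 = vector [vector [0, 0, 0], vector [1, 1, 1], vector [0, 0, 1]]"
    "gen_mat 3 0 1 = vector [vector [0, 0, 0], vector [1, 0, 0], vector [0, 1, 1]]"
    "gen_mat 0 1 2 = vector [vector [0, 0, 0], vector [0, 1, 1], vector [0, 1, 0]]"
    "gen_mat 1 1 2 = vector [vector [0, 1, 1], vector [0, 0, 0], vector [1, 0, 0]]"
    "gen_mat 3 1 2 = vector [vector [0, 1, 1], vector [0, 1, 1], vector [1, 1, 0]]"
    "gen_mat 0 0 2 = vector [vector [0, 0, 0], vector [0, 1, 0], vector [0, 0, 1]]"
    "gen_mat 1 0 2 = vector [vector [0, 0, 0], vector [0, 1, 1], vector [1, 1, 1]]"
    "gen_mat 3 0 2 = vector [vector [0, 0, 0], vector [1, 1, 0], vector [0, 1, 1]]"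
proof -
  have z0: "zp 0 = vector [vector [1, 0, 0], vector [0, 1, 0], vector [0, 0, 1]]"
    by (simp add: mat_def vec_eq_iff forall_3 vector_3)
  have z1: "zp 1 = vector [vector [0, 1, 0], vector [0, 0, 1], vector [1, 1, 0]]"
    by (simp add: blk_pow_Suc mul_zeta_def)
  have block: "gen_mat i 0 1 = frob ** zp i + zp i" "gen_mat i 1 2 = frob ** zp i + zp (i * 2)"
    "gen_mat i 0 2 = (frob ** frob) ** zp (i * 3) + frob ** zp (i * 3)" for i
    by (simp_all add: gen_mat_def blk_pow_Suc numeral_eq_Suc)
  have mult_3: "(3::nat) * 2 = 6" "(3::nat) * 3 = 9"
    by simp_all
  note block = block[of 0] block[of 1] block[of 3]
  show "gen_mat 0 0 1 = vector [vector [0, 0, 0], vector [0, 1, 1], vector [0, 1, 0]]"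
    "gen_mat 1 0 1 = vector [vector [0, 0, 0], vector [1, 1, 1], vector [0, 0, 1]]"
    "gen_mat 3 0 1 = vector [vector [0, 0, 0], vector [1, 0, 0], vector [0, 1, 1]]"
    "gen_mat 0 1 2 = vector [vector [0, 0, 0], vector [0, 1, 1], vector [0, 1, 0]]"
    "gen_mat 1 1 2 = vector [vector [0, 1, 1], vector [0, 0, 0], vector [1, 0, 0]]"
    "gen_mat 3 1 2 = vector [vector [0, 1, 1], vector [0, 1, 1], vector [1, 1, 0]]"
    "gen_mat 0 0 2 = vector [vector [0, 0, 0], vector [0, 1, 0], vector [0, 0, 1]]"
    "gen_mat 1 0 2 = vector [vector [0, 0, 0], vector [0, 1, 1], vector [1, 1, 1]]"
    "gen_mat 3 0 2 = vector [vector [0, 0, 0], vector [1, 1, 0], vector [0, 1, 1]]"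
    unfolding block mult_zero_left mult_1 mult_3
    unfolding zp_9 frob_2 z0 z1 zp_2 zp_3 zp_6
    unfolding frob_def
    by (simp_all add: vec_eq_iff forall_3 vector_3 matrix_matrix_mult_def sum_3)
qed

section \<open>Products of letters up to the second diagonal\<close>

lemma letter_mat_closed: "letter_mat l \<in> carrier UT"
  by (simp add: letter_mat_def gen_mat_closed)

lemma UT_mult_blocks:
  assumes "A \<in> carrier UT" "B \<in> carrier UT"
  shows "(A \<otimes>\<^bsub>UT\<^esub> B) 0 1 = A 0 1 + B 0 1" "(A \<otimes>\<^bsub>UT\<^esub> B) 1 2 = A 1 2 + B 1 2"
    "(A \<otimes>\<^bsub>UT\<^esub> B) 0 2 = A 0 2 + B 0 2 + A 0 1 ** B 1 2"
proof -
  have "{0<..<1::nat} = {}" "{1<..<2::nat} = {}" "{0<..<2::nat} = {1}"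
    by auto
  then show "(A \<otimes>\<^bsub>UT\<^esub> B) 0 1 = A 0 1 + B 0 1" "(A \<otimes>\<^bsub>UT\<^esub> B) 1 2 = A 1 2 + B 1 2"
    "(A \<otimes>\<^bsub>UT\<^esub> B) 0 2 = A 0 2 + B 0 2 + A 0 1 ** B 1 2"
    by (simp_all only: UT_mult_entry[OF assms] zero_less_numeral zero_less_one one_less_numeral_iff
        semiring_norm sum.empty sum.insert add_0_right finite.emptyI empty_iff not_False_eq_True)
qed

text \<open>Since \<open>(1 + n)^-1 = 1 + n + n^2 + ...\<close> in characteristic 2, inversion keeps
  the first diagonal and adds its square to the second.\<close>

lemma letter_mat_blocks:
  "letter_mat (i, e) 0 1 = gen_mat i 0 1"
  "letter_mat (i, e) 1 2 = gen_mat i 1 2"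
  "letter_mat (i, e) 0 2 = gen_mat i 0 2 + (if e then 0 else gen_mat i 0 1 ** gen_mat i 1 2)"
proof -
  let ?A = "gen_mat i" and ?B = "inv\<^bsub>UT\<^esub> gen_mat i"
  have eq: "(?B \<otimes>\<^bsub>UT\<^esub> ?A) m n = \<one>\<^bsub>UT\<^esub> m n" for m n
    by (simp add: gen_mat_closed)
  note block = UT_mult_blocks[OF UT.inv_closed[OF gen_mat_closed] gen_mat_closed, of i i]
  have B: "?B 0 1 = ?A 0 1" "?B 1 2 = ?A 1 2"
    using eq[of 0 1] eq[of 1 2] unfolding block by (simp_all add: UT_one blk_add_eq_0_iff)
  have "?B 0 2 + (?A 0 2 + ?A 0 1 ** ?A 1 2) = 0"
    using eq[of 0 2] unfolding block B by (simp add: UT_one add.assoc)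
  then have "?B 0 2 = ?A 0 2 + ?A 0 1 ** ?A 1 2"
    by (simp only: blk_add_eq_0_iff)
  with B show "letter_mat (i, e) 0 1 = gen_mat i 0 1" "letter_mat (i, e) 1 2 = gen_mat i 1 2"
    "letter_mat (i, e) 0 2 = gen_mat i 0 2 + (if e then 0 else gen_mat i 0 1 ** gen_mat i 1 2)"
    by (simp_all add: letter_mat_def)
qed

lemma trunc_eq_2_blocks:
  assumes "trunc_eq 2 A B"
  shows "A 0 1 = B 0 1" "A 0 2 = B 0 2"
proof -
  have *: "A 0 (0 + d) = B 0 (0 + d)" if "d \<le> 2" for d
    using assms that unfolding trunc_eq_def by blast
  show "A 0 1 = B 0 1" "A 0 2 = B 0 2"
    using *[OF one_le_numeral] *[OF order_refl] by (simp_all only: add_0_left)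
qed

abbreviation letters :: "(nat \<times> bool) set" where
  "letters \<equiv> {0, 1, 3} \<times> UNIV"

text \<open>The second row of the blocks, i.e. the image of \<open>\<zeta>\<close>, carries enough information.\<close>

lemma gen_mat_rows:
  "gen_mat 0 0 1 $ 2 = vector [0, 1, 1]" "gen_mat 1 0 1 $ 2 = vector [1, 1, 1]"
  "gen_mat 3 0 1 $ 2 = vector [1, 0, 0]"
  unfolding gen_mat_blocks by (simp_all add: vector_3)

text \<open>The first diagonal determines the index. The two letters of one index differ on the
  second diagonal by the block of \<open>x_i^2\<close>, which is nonzero.\<close>

lemma letter_mat_trunc_inj:
  assumes "l \<in> letters" "l' \<in> letters" "trunc_eq 2 (letter_mat l) (letter_mat l')"
  shows "l = l'"
proof -
  obtain i e i' e' where l: "l = (i, e)" "l' = (i', e')" "i \<in> {0, 1, 3}" "i' \<in> {0, 1, 3}"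
    using assms by auto
  note eq = trunc_eq_2_blocks[OF assms(3)[unfolded l], unfolded letter_mat_blocks]
  have "gen_mat i 0 1 $ 2 = gen_mat i' 0 1 $ 2"
    using eq(1) by simp
  with l(3,4) have i': "i' = i"
    by (elim insertE emptyE) (simp_all only: gen_mat_rows, simp_all add: vec_eq_iff forall_3 vector_3)
  have "gen_mat i 0 1 ** gen_mat i 1 2 \<noteq> 0"
    using l(3) by (elim insertE emptyE) (simp_all only: gen_mat_blocks,
        simp_all add: vec_eq_iff forall_3 vector_3 matrix_matrix_mult_def sum_3)
  with eq(2) have "e = e'"
    by (cases e; cases e') (simp_all add: i')
  with i' l show ?thesis
    by simp
qed

lemma letter_mat_trunc_nontrivial:
  assumes "l \<in> letters"
  shows "\<not> trunc_eq 2 (letter_mat l) \<one>\<^bsub>UT\<^esub>"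
proof
  assume "trunc_eq 2 (letter_mat l) \<one>\<^bsub>UT\<^esub>"
  moreover obtain i e where l: "l = (i, e)" "i \<in> {0, 1, 3}"
    using assms by auto
  ultimately have "gen_mat i 0 1 $ 2 = 0"
    using trunc_eq_2_blocks(1)[of "letter_mat l" "\<one>\<^bsub>UT\<^esub>"]
    by (simp only: l letter_mat_blocks UT_one) simp
  with l(2) show False
    by (elim insertE emptyE) (simp_all only: gen_mat_rows, simp_all add: vec_eq_iff forall_3 vector_3)
qed

lemma letter_mat_product:
  assumes "l \<in> letters" "l' \<in> letters" "l'' \<in> letters"
    and "trunc_eq 2 (letter_mat l \<otimes>\<^bsub>UT\<^esub> letter_mat l' \<otimes>\<^bsub>UT\<^esub> letter_mat l'') \<one>\<^bsub>UT\<^esub>"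
  shows "(l, l', l'') \<in> {((0, True), (1, True), (3, True)), ((1, True), (3, True), (0, True)),
    ((3, True), (0, True), (1, True)), ((3, False), (1, False), (0, False)),
    ((1, False), (0, False), (3, False)), ((0, False), (3, False), (1, False))}"
proof -
  obtain i e i' e' i'' e'' where l: "l = (i, e)" "l' = (i', e')" "l'' = (i'', e'')"
    and i: "i \<in> {0, 1, 3}" "i' \<in> {0, 1, 3}" "i'' \<in> {0, 1, 3}"
    using assms by auto
  let ?P = "\<lambda>i. gen_mat i 0 1" and ?Q = "\<lambda>i. gen_mat i 1 2"
  let ?W = "\<lambda>i e. gen_mat i 0 2 + (if e then 0 else ?P i ** ?Q i)"
  note closed = letter_mat_closed UT.m_closed
  have "?P i + ?P i' + ?P i'' = 0"
    using trunc_eq_2_blocks(1)[OF assms(4)]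
    by (simp only: UT_mult_blocks closed letter_mat_blocks l UT_one) simp
  then have "(?P i + ?P i' + ?P i'') $ 2 = 0"
    by simp
  then have "gen_mat i 0 1 $ 2 + gen_mat i' 0 1 $ 2 + gen_mat i'' 0 1 $ 2 = 0"
    by simp
  \<comment> \<open>The rows are the nonzero elements of a Klein four-group, and three of them add
    up to 0 only if they are distinct.\<close>
  with i have perm: "(i, i', i'') \<in>
      {(0, 1, 3), (1, 3, 0), (3, 0, 1), (3, 1, 0), (1, 0, 3), (0, 3, 1)}"
    by (elim insertE emptyE) (simp_all only: gen_mat_rows, simp_all add: vec_eq_iff forall_3 vector_3)
  have "?W i e + ?W i' e' + ?P i ** ?Q i' + ?W i'' e'' + (?P i + ?P i') ** ?Q i'' = 0"
    using trunc_eq_2_blocks(2)[OF assms(4)]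
    by (simp only: UT_mult_blocks closed letter_mat_blocks l UT_one) simp
  then have "(?W i e + ?W i' e' + ?P i ** ?Q i' + ?W i'' e'' + (?P i + ?P i') ** ?Q i'') $ 2 = 0"
    by simp
  \<comment> \<open>Six orders and eight sign patterns are tested on the second row of the second
    diagonal.\<close>
  with perm show ?thesis
    unfolding l
    by (elim insertE emptyE; cases e; cases e'; cases e'')
      (simp_all only: prod.inject gen_mat_blocks if_True if_False,
        simp_all add: vec_eq_iff forall_3 vector_3 matrix_matrix_mult_def sum_3)
qed

section \<open>The quotients of the group\<close>

text \<open>Makes the type of blocks finite, for the finiteness of the quotients.\<close>

instance bit :: finite
proof
  have "(UNIV :: bit set) = {0, 1}"
    by (auto intro: bit.exhaust)
  moreover have "finite {0, 1 :: bit}"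
    by simp
  ultimately show "finite (UNIV :: bit set)"
    by (simp only:)
qed

section \<open>The presented group and its matrix representation\<close>

interpretation Gt: presentation "{0..<7}" Gt_relators
proof
  show "Gt_relators \<subseteq> gwords {0..<7}"
    by (auto simp: Gt_relators_def gwords_def)
qed

lemma Gt_eq: "presented_group {0..<7} Gt_relators = Gt"
  by (simp add: Gt_def)

interpretation Gt: group Gt
  using Gt.group_presented_group by (simp only: Gt_eq)

lemmas carrier_Gt = Gt.carrier_presented_group[unfolded Gt_eq]
lemmas one_Gt = Gt.one_presented_group[unfolded Gt_eq]
lemmas mult_Gt = Gt.mult_presented_group[unfolded Gt_eq]

lemma word_mat_simps:
  "word_mat [] = \<one>\<^bsub>UT\<^esub>" "word_mat (l # w) = letter_mat l \<otimes>\<^bsub>UT\<^esub> word_mat w"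
  by (simp_all add: word_mat_def)

lemma word_mat_closed: "word_mat w \<in> carrier UT"
  by (induction w) (simp_all add: word_mat_simps letter_mat_closed)

lemma word_mat_append: "word_mat (u @ v) = word_mat u \<otimes>\<^bsub>UT\<^esub> word_mat v"
  by (induction u) (simp_all add: word_mat_simps word_mat_closed UT_assoc)

lemma word_mat_relator:
  assumes "r \<in> Gt_relators \<union> {[(a, e), (a, \<not> e)] | a e. a \<in> {0..<7}}"
  shows "word_mat r = \<one>\<^bsub>UT\<^esub>"
proof -
  from assms consider i where
      "r = [(i, True), ((i + 1) mod 7, True), ((i + 3) mod 7, True)]"
    | a e where "r = [(a, e), (a, \<not> e)]"
    unfolding Gt_relators_def by blast
  then show ?thesis
  proof cases
    case (1 i)
    have "gen_mat i \<otimes>\<^bsub>UT\<^esub> (gen_mat ((i + 1) mod 7) \<otimes>\<^bsub>UT\<^esub> gen_mat ((i + 3) mod 7)) = \<one>\<^bsub>UT\<^esub>"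
      by (rule gen_mat_relator) (rule mod_mod_trivial)+
    then show ?thesis
      by (simp only: 1 word_mat_simps letter_mat_def fst_conv snd_conv if_True UT.r_one gen_mat_closed)
  next
    case (2 a e)
    then show ?thesis
      by (cases e) (simp_all add: word_mat_simps letter_mat_def gen_mat_closed)
  qed
qed

lemma word_mat_step: "(v, w) \<in> word_step {0..<7} Gt_relators \<Longrightarrow> word_mat v = word_mat w"
proof -
  assume "(v, w) \<in> word_step {0..<7} Gt_relators"
  then obtain u r u' where "v = u @ r @ u'" "w = u @ u'"
      "r \<in> Gt_relators \<union> {[(a, e), (a, \<not> e)] | a e. a \<in> {0..<7}}"
    unfolding word_step_def by blast
  then show ?thesis
    using word_mat_relator[of r] by (simp only: word_mat_append UT.l_one word_mat_closed)
qed

lemma rep_cls: "rep (Gt.cls w) = word_mat w"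
proof -
  have "(SOME v. v \<in> Gt.cls w) \<in> Gt.cls w"
    by (rule someI[of _ w]) simp
  then have "(w, SOME v. v \<in> Gt.cls w) \<in> word_rel {0..<7} Gt_relators"
    by simp
  then have "word_mat w = word_mat (SOME v. v \<in> Gt.cls w)"
    using Gt.word_rel_invariant[where f = word_mat] word_mat_step by blast
  then show ?thesis
    unfolding rep_def by (rule sym)
qed

lemma rep_hom: "rep \<in> hom Gt UT"
  by (rule homI) (auto simp: carrier_Gt mult_Gt rep_cls word_mat_closed word_mat_append)

lemma xgen_eq: "xgen i = Gt.cls [(i, True)]"
  by (simp add: xgen_def)

lemma xgen_closed: "i < 7 \<Longrightarrow> xgen i \<in> carrier Gt"
  by (simp add: xgen_eq carrier_Gt)

lemma rep_xgen: "rep (xgen i) = gen_mat i"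
  by (simp add: xgen_eq rep_cls word_mat_simps letter_mat_def gen_mat_closed)

lemma xgen_relation: "xgen 0 \<otimes>\<^bsub>Gt\<^esub> xgen 1 \<otimes>\<^bsub>Gt\<^esub> xgen 3 = \<one>\<^bsub>Gt\<^esub>"
proof -
  have "[(0, True), (1, True), (3, True)] \<in> Gt_relators"
    unfolding Gt_relators_def by (rule CollectI, rule exI[of _ 0]) simp
  then have "([] @ [(0, True), (1, True), (3, True)] @ [], [] @ []) \<in> word_step {0..<7} Gt_relators"
    by (intro Gt.word_stepI) simp_all
  then have "([(0, True), (1, True), (3, True)], []) \<in> word_rel {0..<7} Gt_relators"
    using Gt.word_rel_stepI by simp
  then show ?thesis
    by (simp add: xgen_eq mult_Gt one_Gt Gt.cls_eq_iff)
qed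

section \<open>The subgroup G and its filtration\<close>

interpretation GG: group GG
  unfolding GG_def by (rule Gt.group_subgroup_generated)

lemma GG_subset: "carrier GG \<subseteq> carrier Gt"
  unfolding GG_def by (rule Gt.carrier_subgroup_generated_subset)

lemma mult_GG: "mult GG = mult Gt" and one_GG: "one GG = one Gt"
  by (simp_all add: GG_def)

lemma xgen_GG: "i \<in> {0, 1, 3} \<Longrightarrow> xgen i \<in> carrier GG"
proof -
  have 01: "xgen 0 \<in> carrier GG" "xgen 1 \<in> carrier GG"
    by (auto simp: GG_def carrier_subgroup_generated xgen_closed intro: generate.incl)
  then have "xgen 0 \<otimes>\<^bsub>Gt\<^esub> xgen 1 \<in> carrier GG"
    using GG.m_closed by (simp add: mult_GG)
  then have "inv\<^bsub>Gt\<^esub> (xgen 0 \<otimes>\<^bsub>Gt\<^esub> xgen 1) \<in> carrier GG"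
    using GG.inv_closed[of "xgen 0 \<otimes>\<^bsub>Gt\<^esub> xgen 1"] by (simp add: GG_def)
  moreover have "xgen 3 = inv\<^bsub>Gt\<^esub> (xgen 0 \<otimes>\<^bsub>Gt\<^esub> xgen 1)"
    using Gt.inv_equality[OF xgen_relation, symmetric] by (simp add: xgen_closed)
  ultimately show "i \<in> {0, 1, 3} \<Longrightarrow> xgen i \<in> carrier GG"
    using 01 by auto
qed

interpretation rep: group_hom GG UT rep
proof
  show "rep \<in> hom GG UT"
    using rep_hom GG_subset by (auto simp: hom_def mult_GG)
qed

text \<open>The diagonal \<open>d = 0\<close> can be included because the diagonal blocks are
  identities.\<close>

lemma Gup_iff: "g \<in> Gup k \<longleftrightarrow> g \<in> carrier GG \<and> trunc_eq k (rep g) \<one>\<^bsub>UT\<^esub>"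
proof -
  have "(\<forall>m d. 1 \<le> d \<and> d \<le> k \<longrightarrow> rep g m (m + d) = 0) \<longleftrightarrow> trunc_eq k (rep g) \<one>\<^bsub>UT\<^esub>"
    if g: "g \<in> carrier GG"
  proof -
    have "rep g m m = mat 1" for m
      using rep.hom_closed[OF g] by (rule UT_carrierD)
    then show ?thesis
      unfolding trunc_eq_def UT_one
      by (auto simp: less_eq_Suc_le[symmetric])
  qed
  then show ?thesis
    by (auto simp: Gup_def)
qed

lemma Gup_carrier: "g \<in> Gup k \<Longrightarrow> g \<in> carrier GG"
  by (simp add: Gup_iff)

lemma Gup_mult_inv_iff:
  assumes "g \<in> carrier GG" "h \<in> carrier GG"
  shows "g \<otimes>\<^bsub>GG\<^esub> inv\<^bsub>GG\<^esub> h \<in> Gup k \<longleftrightarrow> trunc_eq k (rep g) (rep h)"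
proof -
  have eq: "rep (g \<otimes>\<^bsub>GG\<^esub> inv\<^bsub>GG\<^esub> h) = rep g \<otimes>\<^bsub>UT\<^esub> inv\<^bsub>UT\<^esub> rep h"
    using assms by simp
  have "trunc_eq k (rep g \<otimes>\<^bsub>UT\<^esub> inv\<^bsub>UT\<^esub> rep h) \<one>\<^bsub>UT\<^esub> \<longleftrightarrow> trunc_eq k (rep g) (rep h)"
  proof
    assume "trunc_eq k (rep g \<otimes>\<^bsub>UT\<^esub> inv\<^bsub>UT\<^esub> rep h) \<one>\<^bsub>UT\<^esub>"
    from trunc_eq_mult[OF this trunc_eq_refl[of k "rep h"]] show "trunc_eq k (rep g) (rep h)"
      using assms by (simp add: UT.m_assoc)
  next
    assume "trunc_eq k (rep g) (rep h)"
    from trunc_eq_mult[OF this trunc_eq_refl[of k "inv\<^bsub>UT\<^esub> rep h"]]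
    show "trunc_eq k (rep g \<otimes>\<^bsub>UT\<^esub> inv\<^bsub>UT\<^esub> rep h) \<one>\<^bsub>UT\<^esub>"
      using assms by simp
  qed
  then show ?thesis
    using assms by (simp add: Gup_iff eq)
qed

lemma subgroup_Gup: "subgroup (Gup k) GG"
proof (rule GG.subgroupI)
  show "Gup k \<subseteq> carrier GG"
    using Gup_carrier by blast
  have "\<one>\<^bsub>GG\<^esub> \<in> Gup k"
    by (simp add: Gup_iff)
  then show "Gup k \<noteq> {}"
    by blast
next
  fix g assume g: "g \<in> Gup k"
  then have "trunc_eq k (rep \<one>\<^bsub>GG\<^esub>) (rep g)"
    by (simp add: Gup_iff trunc_eq_sym)
  then show "inv\<^bsub>GG\<^esub> g \<in> Gup k"
    using Gup_mult_inv_iff[of "\<one>\<^bsub>GG\<^esub>" g k] Gup_carrier[OF g] by simp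
next
  fix g h assume "g \<in> Gup k" "h \<in> Gup k"
  then show "g \<otimes>\<^bsub>GG\<^esub> h \<in> Gup k"
    using trunc_eq_mult[of k "rep g" "\<one>\<^bsub>UT\<^esub>" "rep h" "\<one>\<^bsub>UT\<^esub>"] by (simp add: Gup_iff)
qed

lemma normal_Gup: "Gup k \<lhd> GG"
  unfolding GG.normal_inv_iff
proof (intro conjI subgroup_Gup ballI)
  fix g n assume g: "g \<in> carrier GG" and n: "n \<in> Gup k"
  have "trunc_eq k (rep g \<otimes>\<^bsub>UT\<^esub> rep n) (rep g \<otimes>\<^bsub>UT\<^esub> \<one>\<^bsub>UT\<^esub>)"
    using n by (intro trunc_eq_mult) (simp_all add: Gup_iff)
  then show "g \<otimes>\<^bsub>GG\<^esub> n \<otimes>\<^bsub>GG\<^esub> inv\<^bsub>GG\<^esub> g \<in> Gup k"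
    using g Gup_carrier[OF n] by (simp add: Gup_mult_inv_iff)
qed

section \<open>The quotients and their finiteness\<close>

definition quot :: "nat \<Rightarrow> elt \<Rightarrow> elt set" where
  "quot k g = Gup k #>\<^bsub>GG\<^esub> g"

lemma group_Gquot: "group (Gquot k)"
  unfolding Gquot_def by (rule normal.factorgroup_is_group[OF normal_Gup])

lemma group_hom_quot: "group_hom GG (Gquot k) (quot k)"
proof (intro group_hom.intro group_hom_axioms.intro GG.group_axioms group_Gquot)
  show "quot k \<in> hom GG (Gquot k)"
    unfolding Gquot_def quot_def[abs_def] by (rule normal.r_coset_hom_Mod[OF normal_Gup])
qed

lemma carrier_Gquot: "carrier (Gquot k) = quot k ` carrier GG"
  by (auto simp: Gquot_def FactGroup_def RCOSETS_def quot_def)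

lemma quot_eq_one_iff: "g \<in> carrier GG \<Longrightarrow> quot k g = \<one>\<^bsub>Gquot k\<^esub> \<longleftrightarrow> g \<in> Gup k"
  using GG.coset_join1[OF _ _ subgroup_Gup] GG.coset_join2[OF _ subgroup_Gup]
  by (auto simp: quot_def Gquot_def)

lemma quot_eq_iff:
  assumes "g \<in> carrier GG" "h \<in> carrier GG"
  shows "quot k g = quot k h \<longleftrightarrow> trunc_eq k (rep g) (rep h)"
proof -
  interpret quot: group_hom GG "Gquot k" "quot k"
    by (rule group_hom_quot)
  have "quot k g = quot k h \<longleftrightarrow> quot k g \<otimes>\<^bsub>Gquot k\<^esub> inv\<^bsub>Gquot k\<^esub> quot k h = \<one>\<^bsub>Gquot k\<^esub>"
    using assms by (metis quot.H.inv_equality quot.H.inv_inv quot.H.r_inv quot.H.inv_closed quot.hom_closed)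
  also have "\<dots> \<longleftrightarrow> g \<otimes>\<^bsub>GG\<^esub> inv\<^bsub>GG\<^esub> h \<in> Gup k"
    using assms quot_eq_one_iff[of "g \<otimes>\<^bsub>GG\<^esub> inv\<^bsub>GG\<^esub> h" k] by simp
  also have "\<dots> \<longleftrightarrow> trunc_eq k (rep g) (rep h)"
    by (rule Gup_mult_inv_iff[OF assms])
  finally show ?thesis .
qed

text \<open>By periodicity, the blocks in rows 0 to 2 on the diagonals 0 to \<open>k\<close>
  determine an element of the quotient.\<close>

lemma finite_Gquot: "finite (carrier (Gquot k))"
proof -
  \<comment> \<open>The value 0 outside the window confines \<open>key\<close> to a finite set of
    functions.\<close>
  define key where "key g = (\<lambda>(m, d). if m < 3 \<and> d \<le> k then rep g m (m + d) else 0)" for g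
  have "key ` carrier GG \<subseteq> {f. \<forall>x. (x \<in> {..<3} \<times> {..k} \<longrightarrow> f x \<in> UNIV) \<and> (x \<notin> {..<3} \<times> {..k} \<longrightarrow> f x = 0)}"
    by (auto simp: key_def)
  moreover have "finite {f :: nat \<times> nat \<Rightarrow> blk. \<forall>x. (x \<in> {..<3} \<times> {..k} \<longrightarrow> f x \<in> UNIV) \<and> (x \<notin> {..<3} \<times> {..k} \<longrightarrow> f x = 0)}"
    by (rule finite_set_of_finite_funs) simp_all
  ultimately have fin: "finite (key ` carrier GG)"
    by (rule finite_subset)
  have key: "quot k g = quot k h" if gh: "g \<in> carrier GG" "h \<in> carrier GG" and "key g = key h" for g h
    unfolding quot_eq_iff[OF gh] trunc_eq_def
  proof (intro allI impI)
    fix m d assume d: "d \<le> k"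
    have periodic: "rep x m (m + d) = rep x (m mod 3) (m mod 3 + d)" if x: "x \<in> carrier GG" for x
    proof -
      have "rep x (3 * q + r) (3 * q + r + d) = rep x r (r + d)" for q r
      proof (induction q)
        case (Suc q)
        then show ?case
          using UT_carrierD(3)[OF rep.hom_closed[OF x], of "3 * q + r" "3 * q + r + d"]
          by (simp add: ac_simps)
      qed simp
      from this[of "m div 3" "m mod 3"] show ?thesis
        by simp
    qed
    show "rep g m (m + d) = rep h m (m + d)"
      using fun_cong[OF \<open>key g = key h\<close>, of "(m mod 3, d)"] d
      by (simp add: key_def periodic[OF gh(1)] periodic[OF gh(2)])
  qed
  have "quot k g = quot k (inv_into (carrier GG) key (key g))" if "g \<in> carrier GG" for g
    using that by (intro key) (simp_all add: inv_into_into f_inv_into_f)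
  then have "quot k ` carrier GG \<subseteq> (\<lambda>y. quot k (inv_into (carrier GG) key y)) ` key ` carrier GG"
    by blast
  then show ?thesis
    unfolding carrier_Gquot by (rule finite_surj[OF fin])
qed

section \<open>Generators of the quotients and the triangle conditions\<close>

definition letter_elt :: "nat \<times> bool \<Rightarrow> elt" where
  "letter_elt l = (if snd l then xgen (fst l) else inv\<^bsub>GG\<^esub> xgen (fst l))"

lemma letter_elt_closed: "l \<in> letters \<Longrightarrow> letter_elt l \<in> carrier GG"
  by (cases l) (simp add: letter_elt_def xgen_GG)

lemma rep_letter_elt: "l \<in> letters \<Longrightarrow> rep (letter_elt l) = letter_mat l"
  by (cases l) (simp add: letter_elt_def letter_mat_def xgen_GG rep_xgen)

lemma xq_eq_quot: "xq k i = quot k (xgen i)"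
  by (simp add: xq_def quot_def)

text \<open>With \<open>k \<ge> 2\<close> every coincidence in the quotient holds up to the second
  diagonal, where the computations with letters apply.\<close>

lemma triangle_2_group_Gquot:
  assumes k: "k \<ge> 2"
  shows "triangle_2_group (Gquot k) (xq k 0) (xq k 1) (xq k 3) (Sq k) (\<lambda>j. quot k ` Gup j) k"
proof -
  interpret quot: group_hom GG "Gquot k" "quot k"
    by (rule group_hom_quot)
  define s where "s l = quot k (letter_elt l)" for l
  have s: "s (i, True) = xq k i" "s (i, False) = inv\<^bsub>Gquot k\<^esub> xq k i" if "i \<in> {0, 1, 3}" for i
    using xgen_GG[OF that] by (simp_all add: s_def letter_elt_def xq_eq_quot)
  have s_simps: "s (0, True) = xq k 0" "s (0, False) = inv\<^bsub>Gquot k\<^esub> xq k 0"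
      "s (1, True) = xq k 1" "s (1, False) = inv\<^bsub>Gquot k\<^esub> xq k 1"
      "s (3, True) = xq k 3" "s (3, False) = inv\<^bsub>Gquot k\<^esub> xq k 3"
    by (rule s, simp)+
  have S: "Sq k = s ` letters"
  proof -
    have "letters = {(0, True), (0, False), (1, True), (1, False), (3, True), (3, False)}"
      by (auto simp: UNIV_bool)
    then show ?thesis
      by (simp only: Sq_def image_insert image_empty s_simps)
  qed
  note closed = letter_elt_closed rep_letter_elt
  have inj: "l = l'" if "l \<in> letters" "l' \<in> letters" "s l = s l'" for l l'
  proof -
    have "trunc_eq k (letter_mat l) (letter_mat l')"
      using that quot_eq_iff[of "letter_elt l" "letter_elt l'" k] by (simp add: s_def closed)
    from letter_mat_trunc_inj[OF that(1,2) trunc_eq_mono[OF this k]] show ?thesis .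
  qed
  have nontrivial: "s l \<noteq> \<one>\<^bsub>Gquot k\<^esub>" if "l \<in> letters" for l
    using that letter_mat_trunc_nontrivial[OF that] trunc_eq_mono[OF _ k]
    by (auto simp: s_def quot_eq_one_iff closed Gup_iff)
  let ?ls = "[(0, True), (0, False), (1, True), (1, False), (3, True), (3, False)]"
  have sub: "set ?ls \<subseteq> letters"
    by simp
  have "inj_on s letters"
    by (rule inj_onI) (rule inj)
  then have "distinct (map s ?ls)"
    unfolding distinct_map using inj_on_subset[OF _ sub] by simp
  moreover have "\<one>\<^bsub>Gquot k\<^esub> \<notin> set (map s ?ls)"
  proof
    assume "\<one>\<^bsub>Gquot k\<^esub> \<in> set (map s ?ls)"
    then obtain l where "\<one>\<^bsub>Gquot k\<^esub> = s l" "l \<in> set ?ls"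
      unfolding set_map by (rule imageE)
    with nontrivial[OF subsetD[OF sub]] show False
      by metis
  qed
  ultimately have "distinct (\<one>\<^bsub>Gquot k\<^esub> # map s ?ls)"
    by (simp only: distinct.simps simp_thms)
  then have dist: "distinct [\<one>\<^bsub>Gquot k\<^esub>, xq k 0, inv\<^bsub>Gquot k\<^esub> xq k 0, xq k 1, inv\<^bsub>Gquot k\<^esub> xq k 1,
      xq k 3, inv\<^bsub>Gquot k\<^esub> xq k 3]"
    by (simp only: list.map s_simps)
  have product: "(l, l', l'') \<in> {((0, True), (1, True), (3, True)), ((1, True), (3, True), (0, True)),
    ((3, True), (0, True), (1, True)), ((3, False), (1, False), (0, False)),
    ((1, False), (0, False), (3, False)), ((0, False), (3, False), (1, False))}"
    if l: "l \<in> letters" "l' \<in> letters" "l'' \<in> letters"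
      and eq: "s l \<otimes>\<^bsub>Gquot k\<^esub> s l' \<otimes>\<^bsub>Gquot k\<^esub> s l'' = \<one>\<^bsub>Gquot k\<^esub>" for l l' l''
  proof -
    let ?g = "letter_elt l \<otimes>\<^bsub>GG\<^esub> letter_elt l' \<otimes>\<^bsub>GG\<^esub> letter_elt l''"
    have "quot k ?g = \<one>\<^bsub>Gquot k\<^esub>"
      using eq l by (simp add: s_def letter_elt_closed)
    moreover have "?g \<in> carrier GG"
      using l by (simp add: letter_elt_closed)
    ultimately have "trunc_eq k (rep ?g) \<one>\<^bsub>UT\<^esub>"
      using quot_eq_one_iff Gup_iff by blast
    then have "trunc_eq 2 (letter_mat l \<otimes>\<^bsub>UT\<^esub> letter_mat l' \<otimes>\<^bsub>UT\<^esub> letter_mat l'') \<one>\<^bsub>UT\<^esub>"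
      using l trunc_eq_mono[OF _ k] by (simp add: closed)
    from letter_mat_product[OF l this] show ?thesis .
  qed
  have triangle: "triangle_group (Gquot k) (xq k 0) (xq k 1) (xq k 3) (Sq k)"
  proof (intro triangle_group.intro group_Gquot triangle_group_axioms.intro dist)
    show "Sq k = {xq k 0, inv\<^bsub>Gquot k\<^esub> xq k 0, xq k 1, inv\<^bsub>Gquot k\<^esub> xq k 1, xq k 3, inv\<^bsub>Gquot k\<^esub> xq k 3}"
      by (rule Sq_def)
    show "finite (carrier (Gquot k))"
      by (rule finite_Gquot)
    show "xq k 0 \<in> carrier (Gquot k)" "xq k 1 \<in> carrier (Gquot k)" "xq k 3 \<in> carrier (Gquot k)"
      using xgen_GG by (simp_all add: xq_eq_quot)
    have "quot k (xgen 0 \<otimes>\<^bsub>GG\<^esub> xgen 1 \<otimes>\<^bsub>GG\<^esub> xgen 3) = \<one>\<^bsub>Gquot k\<^esub>"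
      using xgen_relation by (simp add: mult_GG flip: one_GG)
    then show "xq k 0 \<otimes>\<^bsub>Gquot k\<^esub> xq k 1 \<otimes>\<^bsub>Gquot k\<^esub> xq k 3 = \<one>\<^bsub>Gquot k\<^esub>"
      using xgen_GG by (simp add: xq_eq_quot)
  next
    fix x y z
    assume "x \<in> Sq k" "y \<in> Sq k" "z \<in> Sq k"
      and eq: "x \<otimes>\<^bsub>Gquot k\<^esub> y \<otimes>\<^bsub>Gquot k\<^esub> z = \<one>\<^bsub>Gquot k\<^esub>"
    then obtain l l' l'' where l: "l \<in> letters" "l' \<in> letters" "l'' \<in> letters"
        and xyz: "x = s l" "y = s l'" "z = s l''"
      unfolding S by blast
    from product[OF l eq[unfolded xyz]]
    show "(x, y, z) \<in> {(xq k 0, xq k 1, xq k 3), (xq k 1, xq k 3, xq k 0), (xq k 3, xq k 0, xq k 1),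
      (inv\<^bsub>Gquot k\<^esub> xq k 3, inv\<^bsub>Gquot k\<^esub> xq k 1, inv\<^bsub>Gquot k\<^esub> xq k 0),
      (inv\<^bsub>Gquot k\<^esub> xq k 1, inv\<^bsub>Gquot k\<^esub> xq k 0, inv\<^bsub>Gquot k\<^esub> xq k 3),
      (inv\<^bsub>Gquot k\<^esub> xq k 0, inv\<^bsub>Gquot k\<^esub> xq k 3, inv\<^bsub>Gquot k\<^esub> xq k 1)}"
      unfolding xyz by (elim insertE emptyE) (simp_all only: prod.inject s_simps insert_iff simp_thms)
  qed
  have series: "elementary_central_series (Gquot k) (\<lambda>j. quot k ` Gup j) k"
  proof (intro elementary_central_series.intro group_Gquot elementary_central_series_axioms.intro)
    show "finite (carrier (Gquot k))"
      by (rule finite_Gquot)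
    show "quot k ` Gup j \<subseteq> carrier (Gquot k)" for j
      using Gup_carrier by auto
    have "trunc_eq 0 (rep g) \<one>\<^bsub>UT\<^esub>" if "g \<in> carrier GG" for g
      using UT_carrierD(2)[OF rep.hom_closed[OF that]] by (simp add: trunc_eq_def UT_one)
    then have "Gup 0 = carrier GG"
      by (auto simp: Gup_iff)
    then show "quot k ` Gup 0 = carrier (Gquot k)"
      by (simp add: carrier_Gquot)
    have "\<one>\<^bsub>GG\<^esub> \<in> Gup k"
      by (simp add: Gup_iff)
    then show "quot k ` Gup k = {\<one>\<^bsub>Gquot k\<^esub>}"
      using quot_eq_one_iff Gup_carrier by blast
  next
    fix z j assume "z \<in> quot k ` Gup j"
    then obtain g where g: "g \<in> Gup j" "z = quot k g"
      by blast
    have "g \<otimes>\<^bsub>GG\<^esub> g \<in> Gup (Suc j)"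
      using g trunc_eq_one_square[of "rep g" j] by (simp add: Gup_iff)
    then show "z \<otimes>\<^bsub>Gquot k\<^esub> z \<in> quot k ` Gup (Suc j)"
      using g Gup_carrier[OF g(1)] by (auto intro!: image_eqI[of _ _ "g \<otimes>\<^bsub>GG\<^esub> g"])
  next
    fix z x j assume "z \<in> quot k ` Gup j" "x \<in> carrier (Gquot k)"
    then obtain g h where g: "g \<in> Gup j" "z = quot k g" and h: "h \<in> carrier GG" "x = quot k h"
      unfolding carrier_Gquot by blast
    note gc = Gup_carrier[OF g(1)]
    \<comment> \<open>The commutator of \<open>g\<close> and \<open>h\<close>, which lies one step
      deeper in the filtration.\<close>
    let ?c = "(g \<otimes>\<^bsub>GG\<^esub> h) \<otimes>\<^bsub>GG\<^esub> inv\<^bsub>GG\<^esub> (h \<otimes>\<^bsub>GG\<^esub> g)"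
    have "?c \<in> Gup (Suc j)"
      using g(1) gc h trunc_eq_one_commute[of "rep g" "rep h" j]
      by (subst Gup_mult_inv_iff) (simp_all add: Gup_iff)
    moreover have "g \<otimes>\<^bsub>GG\<^esub> h = ?c \<otimes>\<^bsub>GG\<^esub> (h \<otimes>\<^bsub>GG\<^esub> g)"
      using gc h by (simp add: GG.m_assoc del: GG.inv_mult_group)
    then have "quot k (g \<otimes>\<^bsub>GG\<^esub> h) = quot k (?c \<otimes>\<^bsub>GG\<^esub> (h \<otimes>\<^bsub>GG\<^esub> g))"
      by simp
    then have "z \<otimes>\<^bsub>Gquot k\<^esub> x = quot k ?c \<otimes>\<^bsub>Gquot k\<^esub> (x \<otimes>\<^bsub>Gquot k\<^esub> z)"
      unfolding g(2) h(2) using gc h(1) by (simp only: quot.hom_mult GG.m_closed GG.inv_closed)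
    ultimately show "\<exists>c\<in>quot k ` Gup (Suc j). z \<otimes>\<^bsub>Gquot k\<^esub> x = c \<otimes>\<^bsub>Gquot k\<^esub> (x \<otimes>\<^bsub>Gquot k\<^esub> z)"
      by blast
  qed
  from triangle series show ?thesis
    by (rule triangle_2_group.intro)
qed

theorem theorem3p1:
  fixes k :: nat
  assumes "k \<ge> 2"
  shows
    "(\<forall>(F :: elt set + elt set set \<Rightarrow> 'b::real_field) (\<nu>::real).
        \<nu> \<in> {-3..3} \<longrightarrow> eigenfunction (Tgraph k) \<nu> F \<longrightarrow>
          \<nu>\<^sup>2 - 3 \<in> {-3..6} \<and> eigenfunction (Xgraph k) (\<nu>\<^sup>2 - 3) (\<lambda>v. F (Inl v))) \<and>
     (\<forall>(f :: elt set \<Rightarrow> 'b) (\<mu>::real).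
        \<mu> \<in> {-6..6} - {-3} \<longrightarrow> eigenfunction (Xgraph k) \<mu> f \<longrightarrow>
          (\<forall>\<epsilon>\<in>{1, -1}.
             eigenfunction (Tgraph k) (\<epsilon> * sqrt (\<mu> + 3))
               (case_sum f
                 (\<lambda>D. of_real (\<epsilon> * (1 / sqrt (\<mu> + 3))) *
                        (\<Sum>w | adj (Tgraph k) (Inr D) (Inl w). f w))))) \<and>
     (\<forall>f :: elt set \<Rightarrow> 'b.
        eigenfunction (Xgraph k) (-3) f \<longrightarrow>
          (eigenfunction (Tgraph k) 0 (case_sum f (\<lambda>_. 0)) \<longleftrightarrow>
             (\<forall>D\<in>triangles (Xgraph k). (\<Sum>v\<in>D. f v) = 0)))"
proof -
  interpret triangle_2_group "Gquot k" "xq k 0" "xq k 1" "xq k 3" "Sq k" "\<lambda>j. quot k ` Gup j" k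
    by (rule triangle_2_group_Gquot[OF assms])
  have X: "Xgraph k = cayley_graph (Gquot k) (Sq k)" and T: "Tgraph k = delta_Y (Xgraph k)"
    by (simp_all add: Xgraph_def Tgraph_def)
  have range: "\<nu>\<^sup>2 - 3 \<in> {-3..6}" if "\<nu> \<in> {-3..3}" for \<nu> :: real
  proof -
    have "\<nu>\<^sup>2 \<le> 3\<^sup>2"
      using that by (intro power2_le_iff_abs_le[THEN iffD2]) auto
    then show ?thesis
      by simp
  qed
  show ?thesis
    unfolding T X
  proof (intro conjI allI impI ballI)
    fix F :: "elt set + elt set set \<Rightarrow> 'b" and \<nu> :: real
    assume "\<nu> \<in> {-3..3}" and F: "eigenfunction (delta_Y \<Gamma>) \<nu> F"
    then show "\<nu>\<^sup>2 - 3 \<in> {-3..6}"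
      by (intro range)
    \<comment> \<open>Injectivity of the incidence map excludes an \<open>F\<close> supported on the
      triangles alone.\<close>
    show "eigenfunction \<Gamma> (\<nu>\<^sup>2 - 3) (\<lambda>v. F (Inl v))"
      by (rule eigenfunction_of_delta_Y[OF incidence_injective F])
  next
    fix f :: "elt set \<Rightarrow> 'b" and \<mu> \<epsilon> :: real
    assume "\<mu> \<in> {-6..6} - {-3}" "eigenfunction \<Gamma> \<mu> f" "\<epsilon> \<in> {1, -1}"
    then show "eigenfunction (delta_Y \<Gamma>) (\<epsilon> * sqrt (\<mu> + 3))
        (case_sum f (\<lambda>D. of_real (\<epsilon> * (1 / sqrt (\<mu> + 3))) *
          (\<Sum>w | adj (delta_Y \<Gamma>) (Inr D) (Inl w). f w)))"
      by (intro eigenfunction_delta_Y) simp_all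
  next
    fix f :: "elt set \<Rightarrow> 'b"
    assume "eigenfunction \<Gamma> (-3) f"
    then show "eigenfunction (delta_Y \<Gamma>) 0 (case_sum f (\<lambda>_. 0)) \<longleftrightarrow>
        (\<forall>D\<in>triangles \<Gamma>. (\<Sum>v\<in>D. f v) = 0)"
      by (rule eigenfunction_delta_Y_zero_iff)
  qed
qed

end
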